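(* Let $R$ be a rule on the domain $\mathcal{D}$ of museum pass problems with consortia. Then $R$ satisfies composition, dummy, splitting-proofness of museums, splitting-proofness of consortia and consortia consistency if and only if $R$ is the proportional-proportional rule $R^{PP}$, where for each $D=(M,P,N,\pi,C)\in\mathcal{D}$ and each $i\in M$, $$R^{PP}_{i}(D)=\sum_{a \in N^0_i} \frac{\pi^{-i}}{\sum_{j \in M_a \cap P^{(i)}} \pi^{-j}}\, \frac{\pi^{(i)}}{\sum_{t \in K^0_a}\pi^t}\, \pi^0+\sum_{a \in N^{(i)}_i} \frac{\pi^{-i}}{\sum_{j\in M_a}\pi^{-j}}\, \pi^{(i)}+|N^{-i}|\,\pi^{-i}.$$
   Context: **Problems.** Fix an infinite set $\mathbb{M}$ of potential museums containing the positive integers, and an infinite set $\mathbb{N}$ of potential pass holders. A museum pass problem with consortia (a *problem* ) is a 5-tuple $D=(M,P,N,\pi,C)$ where: - $M$ is a finite non-empty subset of $\mathbb{M}$ (the museums), $m=|M|$. - $P=\{P_1,\dots,P_s\}$ is a partition of $M$ into non-empty sets (the consortia). The enumeration is only a notational device; data carrying superscript $t$ are attached to the consortium $P_t$. - $N$ is a family of pairwise disjoint finite subsets of $\mathbb{N}$ (each possibly empty): $N^{-i}$ for each $i\in M$ (holders of the individual pass of museum $i$), $N^0$ (holders of the general pass), and $N^t$ for each consortium $P_t$ (holders of the pass of consortium $P_t$). If $P_t=\{i\}$ is a singleton, then $N^{-i}=\varnothing$. - $\pi$ is a family of strictly positive real prices $\pi^{-i}$ ($i\in M$), $\pi^0$,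 $\pi^t$ ($P_t\in P$). If $P_t=\{i\}$, then $\pi^{-i}=\pi^t$. - $C$ is a family of $0/1$ matrices: $C^{-i}$ with the single row $i$ and columns $N^{-i}$; $C^0$ with rows $M$ and columns $N^0$; $C^t$ with rows $P_t$ and columns $N^t$. An entry indexed by $(i,a)$ is $1$ iff holder $a$ visits museum $i$. Every column of every matrix contains at least one $1$ (every holder visits at least one museum). A matrix with no columns is written $\varnothing$. $\mathcal{D}$ is the set of all problems; $\mathcal{D}^0\subset\mathcal{D}$ is the set of problems in which all the holder sets other than $N^0$ are empty. **Notation.** $P^{(i)}$ is the unique consortium containing $i$, and $N^{(i)},\pi^{(i)},C^{(i)}$ are the set of holders, price and matrix attached to that consortium. For each pass index $\sigma$ (i.e. $\sigma=-j$ with $j \in M$, $\sigma=0$, or $\sigma=t$ a consortium), $N^\sigma_i=\{a\in N^\sigma: C^\sigma_{ia}=1\}$. $M_a$ is the set of museums visited by holder $a$. For $a\in N^0$, $K^0_a=\{k: C^0_{ia}=1\text{ for some } i\in P_k\}$. **Rules.** The total revenue is $E=\sum_{i\in M}|N^{-i}|\pi^{-i}+|N^0|\pi^0+\sum_{t=1}^s|N^t|\pi^t$. A *rule* is a map $R$ assigning to each $D\in\mathcal{D}$ a vector $R(D)\in\mathbb{R}_+^M$ with $\sum_{i\in M}R_i(D)=E$. **Axioms.** - *Composition*: for all $(M,P,N_1,\pi,C_1),(M,P,N_2,\pi,C_2)\in\mathcal{D}$ such that no pass holder occurs in both $N_1$ and $N_2$, $R(M,P,N_1\cup N_2,\pi,(C_1,C_2))=R(M,P,N_1,\pi,C_1)+R(M,P,N_2,\pi,C_2)$,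 where $N_1\cup N_2$ is the componentwise union and $(C_1,C_2)$ is the componentwise concatenation of columns. - *Dummy*: for each $D\in\mathcal{D}$ and $i\in M$, if for each $\sigma\in\{-i,0,(i)\}$ either $C^\sigma=\varnothing$ or $C^\sigma_{ia}=0$ for all $a\in N^\sigma$, then $R_i(D)=0$. - *Splitting-proofness of museums*: let $D=(M,P,N,\pi,C)\in\mathcal{D}$ and $i\in M$, and let $D'=(M',P',N',\pi',C')\in\mathcal{D}$ be obtained by splitting $i$ into distinct museums $i_1,\dots,i_r\in\mathbb{M}\setminus(M\setminus\{i\})$: $M'=(M\setminus\{i\})\cup\{i_1,\dots,i_r\}$; in $P'$ the consortium $P^{(i)}$ is replaced by $(P^{(i)}\setminus\{i\})\cup\{i_1,\dots,i_r\}$ (keeping its pass price and its set of pass holders), other consortia unchanged; $N^{-i}$ is replaced by $N^{-i_1},\dots,N^{-i_r}$, each a (disjoint) copy of $N^{-i}$; $\pi^{-i}$ is replaced by positive prices $\pi^{-i_1},\dots,\pi^{-i_r}$ with $\sum_{h=1}^r\pi^{-i_h}=\pi^{-i}$; in $C^0$ and in $C^{(i)}$ the row of $i$ is replaced by $r$ identical copies of it, indexed by $i_1,\dots,i_r$, and each $C^{-i_h}$ is a copy of $C^{-i}$; all other data are unchanged. Then $R_j(D)=R_j(D')$ for each $j\in M\setminus\{i\}$. - *Splitting-proofness of consortia*: let $D=(M,P,N,\pi,C)\in\mathcal{D}$ and $P_k=\{i_1,\dots,i_r\}\in P$, and let $D'=(M',P',N',\pi',C')\in\mathcal{D}$ be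 obtained by splitting $P_k$ into consortia $P_{k_l}=\{i^l_1,\dots,i^l_r\}$, $l=1,\dots,t$, where the $i^l_h$ are distinct elements of $\mathbb{M}\setminus(M\setminus P_k)$: $M'=(M\setminus P_k)\cup\bigcup_{l=1}^tP_{k_l}$; $P'=(P\setminus\{P_k\})\cup\{P_{k_1},\dots,P_{k_t}\}$; each $N^{k_l}$ is a (disjoint) copy of $N^k$ and each $N^{-i^l_h}$ is a (disjoint) copy of $N^{-i_h}$; the new prices are positive with $\sum_{l=1}^t\pi^{k_l}=\pi^k$ and $\sum_{l=1}^t\pi^{-i^l_h}=\pi^{-i_h}$ for every $h\in\{1,\dots,r\}$; $C'^0_{i^l_ha}=C^0_{i_ha}$ for all $a\in N^0$ and all $l,h$; each $C^{k_l}$ is a copy of $C^k$ (row $i^l_h$ corresponding to row $i_h$) and each $C^{-i^l_h}$ is a copy of $C^{-i_h}$; all other data are unchanged. Then $\sum_{j\in P_q}R_j(D)=\sum_{j\in P_q}R_j(D')$ for each $P_q\in P\setminus\{P_k\}$. - *Consortia consistency*: for each $D=(M,P,N,\pi,C)\in\mathcal{D}^0$ with $P=\{P_1,\dots,P_s\}$ and each $P_k\in P$, $\sum_{i\in P_k}R_i(D)=R_k(\hat D)$, where $\hat D=(\{1,\dots,s\},\hat P^s,\hat N,\hat\pi,\hat C)\in\mathcal{D}^0$ is the *reduced problem*: $\hat P^s=\{\{1\},\dots,\{s\}\}$, $\hat N^0=N^0$ and all other holder sets are empty, $\hat\pi^0=\pi^0$, $\hat\pi^{-t}=\hat\pi^t=\pi^t$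 for each $t\in\{1,\dots,s\}$, and $\hat C^0_{ta}=1$ if there is $i\in P_t$ with $C^0_{ia}=1$ and $\hat C^0_{ta}=0$ otherwise. *)

theory Defs
  imports Complex_Main "HOL-Library.Disjoint_Sets"
begin

text \<open>
  Museum pass problems with consortia. A consortium is identified with its set of museums, so that
  no enumeration of the partition enters the data of a problem. \<open>Ind i\<close>, \<open>Gen\<close> and \<open>Con Q\<close> are the
  pass indices written \<open>-i\<close>, \<open>0\<close> and \<open>t\<close> (with \<open>Q = P_t\<close>).
\<close>

datatype 'm pass = Ind 'm | Gen | Con "'m set"

record ('m, 'h) problem =
  museums :: "'m set"
  consortia :: "'m set set"
  holders :: "'m pass \<Rightarrow> 'h set"
  price :: "'m pass \<Rightarrow> real"
  visit :: "'m pass \<Rightarrow> 'm \<Rightarrow> 'h \<Rightarrow> nat"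

definition passes :: "('m, 'h) problem \<Rightarrow> 'm pass set" where
  "passes D = Ind ` museums D \<union> {Gen} \<union> Con ` consortia D"

fun pass_rows :: "('m, 'h) problem \<Rightarrow> 'm pass \<Rightarrow> 'm set" where
  "pass_rows D (Ind i) = {i}"
| "pass_rows D Gen = museums D"
| "pass_rows D (Con Q) = Q"

text \<open>
  Outside their index sets the families of holders, prices and matrix entries are given the default
  values \<open>{}\<close>, \<open>0\<close> and \<open>0\<close>. Hence two records in \<open>problems MM NN\<close> are equal iff they describe the
  same problem, and a rule cannot depend on irrelevant values.
\<close>

definition problems :: "'m set \<Rightarrow> 'h set \<Rightarrow> ('m, 'h) problem set" where
  "problems MM NN = {D.
     finite (museums D) \<and> museums D \<noteq> {} \<and> museums D \<subseteq> MM \<and>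
     partition_on (museums D) (consortia D) \<and>
     (\<forall>\<sigma>\<in>passes D. finite (holders D \<sigma>) \<and> holders D \<sigma> \<subseteq> NN) \<and>
     disjoint_family_on (holders D) (passes D) \<and>
     (\<forall>\<sigma>\<in>passes D. price D \<sigma> > 0) \<and>
     (\<forall>i. {i} \<in> consortia D \<longrightarrow>
        holders D (Ind i) = {} \<and> price D (Ind i) = price D (Con {i})) \<and>
     (\<forall>\<sigma>\<in>passes D. \<forall>i\<in>pass_rows D \<sigma>. \<forall>a\<in>holders D \<sigma>. visit D \<sigma> i a \<in> {0, 1}) \<and>
     (\<forall>\<sigma>\<in>passes D. \<forall>a\<in>holders D \<sigma>. \<exists>i\<in>pass_rows D \<sigma>. visit D \<sigma> i a = 1) \<and>
     (\<forall>\<sigma>. \<sigma> \<notin> passes D \<longrightarrow> holders D \<sigma> = {} \<and> price D \<sigma> = 0) \<and>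
     (\<forall>\<sigma> i a. \<not> (\<sigma> \<in> passes D \<and> i \<in> pass_rows D \<sigma> \<and> a \<in> holders D \<sigma>) \<longrightarrow> visit D \<sigma> i a = 0)}"

definition general_problems :: "'m set \<Rightarrow> 'h set \<Rightarrow> ('m, 'h) problem set" where
  "general_problems MM NN = {D \<in> problems MM NN. \<forall>\<sigma>\<in>passes D. \<sigma> \<noteq> Gen \<longrightarrow> holders D \<sigma> = {}}"

definition consortium_of :: "('m, 'h) problem \<Rightarrow> 'm \<Rightarrow> 'm set" where
  "consortium_of D i = (THE Q. Q \<in> consortia D \<and> i \<in> Q)"

definition revenue :: "('m, 'h) problem \<Rightarrow> real" where
  "revenue D = (\<Sum>i\<in>museums D. real (card (holders D (Ind i))) * price D (Ind i))
     + real (card (holders D Gen)) * price D Gen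
     + (\<Sum>Q\<in>consortia D. real (card (holders D (Con Q))) * price D (Con Q))"

text \<open>Only the values \<open>R D i\<close> with \<open>D \<in> problems MM NN\<close> and \<open>i \<in> museums D\<close> are meaningful.\<close>

definition is_rule ::
  "'m set \<Rightarrow> 'h set \<Rightarrow> (('m, 'h) problem \<Rightarrow> 'm \<Rightarrow> real) \<Rightarrow> bool" where
  "is_rule MM NN R \<longleftrightarrow>
     (\<forall>D\<in>problems MM NN. (\<forall>i\<in>museums D. R D i \<ge> 0) \<and> (\<Sum>i\<in>museums D. R D i) = revenue D)"

definition merge :: "('m, 'h) problem \<Rightarrow> ('m, 'h) problem \<Rightarrow> ('m, 'h) problem" where
  "merge D1 D2 = D1\<lparr>
     holders := (\<lambda>\<sigma>. holders D1 \<sigma> \<union> holders D2 \<sigma>),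
     visit := (\<lambda>\<sigma> i a. if a \<in> holders D1 \<sigma> then visit D1 \<sigma> i a else visit D2 \<sigma> i a)\<rparr>"

definition composition ::
  "'m set \<Rightarrow> 'h set \<Rightarrow> (('m, 'h) problem \<Rightarrow> 'm \<Rightarrow> real) \<Rightarrow> bool" where
  "composition MM NN R \<longleftrightarrow>
     (\<forall>D1\<in>problems MM NN. \<forall>D2\<in>problems MM NN.
        museums D1 = museums D2 \<and> consortia D1 = consortia D2 \<and> price D1 = price D2 \<and>
        (\<Union>\<sigma>\<in>passes D1. holders D1 \<sigma>) \<inter> (\<Union>\<sigma>\<in>passes D2. holders D2 \<sigma>) = {} \<longrightarrow>
        (\<forall>i\<in>museums D1. R (merge D1 D2) i = R D1 i + R D2 i))"

definition dummy :: "'m set \<Rightarrow> 'h set \<Rightarrow> (('m, 'h) problem \<Rightarrow> 'm \<Rightarrow> real) \<Rightarrow> bool" where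
  "dummy MM NN R \<longleftrightarrow>
     (\<forall>D\<in>problems MM NN. \<forall>i\<in>museums D.
        (\<forall>\<sigma>\<in>{Ind i, Gen, Con (consortium_of D i)}.
           holders D \<sigma> = {} \<or> (\<forall>a\<in>holders D \<sigma>. visit D \<sigma> i a = 0)) \<longrightarrow>
        R D i = 0)"

definition same_pass :: "('m, 'h) problem \<Rightarrow> ('m, 'h) problem \<Rightarrow> 'm pass \<Rightarrow> bool" where
  "same_pass D D' \<sigma> \<longleftrightarrow>
     holders D' \<sigma> = holders D \<sigma> \<and> price D' \<sigma> = price D \<sigma> \<and> visit D' \<sigma> = visit D \<sigma>"

text \<open>
  The holders of pass \<open>\<tau>\<close> in \<open>D'\<close> and their matrix are a copy of those of pass \<open>\<sigma>\<close> in \<open>D\<close>, the row of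
  museum \<open>j\<close> becoming the row of \<open>\<rho> j\<close>. That different copies are disjoint is part of
  \<open>D' \<in> problems MM NN\<close>.
\<close>

definition is_copy ::
  "('m, 'h) problem \<Rightarrow> 'm pass \<Rightarrow> ('m, 'h) problem \<Rightarrow> 'm pass \<Rightarrow> ('m \<Rightarrow> 'm) \<Rightarrow> bool" where
  "is_copy D \<sigma> D' \<tau> \<rho> \<longleftrightarrow>
     (\<exists>f. bij_betw f (holders D \<sigma>) (holders D' \<tau>) \<and>
          (\<forall>j\<in>pass_rows D \<sigma>. \<forall>a\<in>holders D \<sigma>. visit D' \<tau> (\<rho> j) (f a) = visit D \<sigma> j a))"

text \<open>\<open>D'\<close> arises from \<open>D\<close> by splitting museum \<open>i\<close> into the set \<open>I = {i\<^sub>1, \<dots>, i\<^sub>r}\<close>, which may contain \<open>i\<close>.\<close>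

definition splits_museum ::
  "'m set \<Rightarrow> ('m, 'h) problem \<Rightarrow> 'm \<Rightarrow> 'm set \<Rightarrow> ('m, 'h) problem \<Rightarrow> bool" where
  "splits_museum MM D i I D' \<longleftrightarrow>
     (let Q = consortium_of D i; Q' = (Q - {i}) \<union> I in
        i \<in> museums D \<and> finite I \<and> I \<noteq> {} \<and> I \<subseteq> MM - (museums D - {i}) \<and>
        museums D' = (museums D - {i}) \<union> I \<and>
        consortia D' = (consortia D - {Q}) \<union> {Q'} \<and>
        (\<forall>h\<in>I. is_copy D (Ind i) D' (Ind h) (\<lambda>_. h) \<and> price D' (Ind h) > 0) \<and>
        (\<Sum>h\<in>I. price D' (Ind h)) = price D (Ind i) \<and>
        holders D' Gen = holders D Gen \<and> price D' Gen = price D Gen \<and>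
        (\<forall>a\<in>holders D Gen.
           (\<forall>h\<in>I. visit D' Gen h a = visit D Gen i a) \<and>
           (\<forall>j\<in>museums D - {i}. visit D' Gen j a = visit D Gen j a)) \<and>
        holders D' (Con Q') = holders D (Con Q) \<and> price D' (Con Q') = price D (Con Q) \<and>
        (\<forall>a\<in>holders D (Con Q).
           (\<forall>h\<in>I. visit D' (Con Q') h a = visit D (Con Q) i a) \<and>
           (\<forall>j\<in>Q - {i}. visit D' (Con Q') j a = visit D (Con Q) j a)) \<and>
        (\<forall>j\<in>museums D - {i}. same_pass D D' (Ind j)) \<and>
        (\<forall>S\<in>consortia D - {Q}. same_pass D D' (Con S)))"

definition splitting_proof_museums ::
  "'m set \<Rightarrow> 'h set \<Rightarrow> (('m, 'h) problem \<Rightarrow> 'm \<Rightarrow> real) \<Rightarrow> bool" where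
  "splitting_proof_museums MM NN R \<longleftrightarrow>
     (\<forall>D\<in>problems MM NN. \<forall>D'\<in>problems MM NN. \<forall>i\<in>museums D. \<forall>I.
        splits_museum MM D i I D' \<longrightarrow> (\<forall>j\<in>museums D - {i}. R D j = R D' j))"

text \<open>
  \<open>D'\<close> arises from \<open>D\<close> by splitting the consortium \<open>K\<close> into \<open>t\<close> consortia \<open>c l ` K\<close>, where
  \<open>l \<in> {1..t}\<close> and \<open>c l h\<close> is the \<open>l\<close>-th copy of the museum \<open>h \<in> K\<close>.
\<close>

definition splits_consortium ::
  "'m set \<Rightarrow> ('m, 'h) problem \<Rightarrow> 'm set \<Rightarrow> nat \<Rightarrow> (nat \<Rightarrow> 'm \<Rightarrow> 'm) \<Rightarrow> ('m, 'h) problem \<Rightarrow> bool"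
  where
  "splits_consortium MM D K t c D' \<longleftrightarrow>
     K \<in> consortia D \<and> t \<ge> 1 \<and>
     inj_on (\<lambda>(l, h). c l h) ({1..t} \<times> K) \<and>
     (\<forall>l\<in>{1..t}. \<forall>h\<in>K. c l h \<in> MM - (museums D - K)) \<and>
     museums D' = (museums D - K) \<union> (\<Union>l\<in>{1..t}. c l ` K) \<and>
     consortia D' = (consortia D - {K}) \<union> (\<lambda>l. c l ` K) ` {1..t} \<and>
     (\<forall>l\<in>{1..t}. is_copy D (Con K) D' (Con (c l ` K)) (c l) \<and> price D' (Con (c l ` K)) > 0) \<and>
     (\<forall>l\<in>{1..t}. \<forall>h\<in>K. is_copy D (Ind h) D' (Ind (c l h)) (c l) \<and> price D' (Ind (c l h)) > 0) \<and>
     (\<Sum>l\<in>{1..t}. price D' (Con (c l ` K))) = price D (Con K) \<and>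
     (\<forall>h\<in>K. (\<Sum>l\<in>{1..t}. price D' (Ind (c l h))) = price D (Ind h)) \<and>
     holders D' Gen = holders D Gen \<and> price D' Gen = price D Gen \<and>
     (\<forall>a\<in>holders D Gen.
        (\<forall>l\<in>{1..t}. \<forall>h\<in>K. visit D' Gen (c l h) a = visit D Gen h a) \<and>
        (\<forall>j\<in>museums D - K. visit D' Gen j a = visit D Gen j a)) \<and>
     (\<forall>j\<in>museums D - K. same_pass D D' (Ind j)) \<and>
     (\<forall>S\<in>consortia D - {K}. same_pass D D' (Con S))"

definition splitting_proof_consortia ::
  "'m set \<Rightarrow> 'h set \<Rightarrow> (('m, 'h) problem \<Rightarrow> 'm \<Rightarrow> real) \<Rightarrow> bool" where
  "splitting_proof_consortia MM NN R \<longleftrightarrow>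
     (\<forall>D\<in>problems MM NN. \<forall>D'\<in>problems MM NN. \<forall>K\<in>consortia D. \<forall>t c.
        splits_consortium MM D K t c D' \<longrightarrow>
        (\<forall>Q\<in>consortia D - {K}. (\<Sum>j\<in>Q. R D j) = (\<Sum>j\<in>Q. R D' j)))"

text \<open>
  The reduced problem of \<open>D\<close> for the enumeration \<open>e\<close> of its consortia; \<open>num t\<close> is the positive
  integer \<open>t\<close> viewed as a museum. Together with \<open>D' \<in> general_problems MM NN\<close> the conditions
  determine \<open>D'\<close> uniquely.
\<close>

definition is_reduced ::
  "(nat \<Rightarrow> 'm) \<Rightarrow> (nat \<Rightarrow> 'm set) \<Rightarrow> ('m, 'h) problem \<Rightarrow> ('m, 'h) problem \<Rightarrow> bool" where
  "is_reduced num e D D' \<longleftrightarrow>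
     (let s = card (consortia D) in
        museums D' = num ` {1..s} \<and>
        consortia D' = (\<lambda>t. {num t}) ` {1..s} \<and>
        holders D' Gen = holders D Gen \<and> (\<forall>\<sigma>. \<sigma> \<noteq> Gen \<longrightarrow> holders D' \<sigma> = {}) \<and>
        price D' Gen = price D Gen \<and>
        (\<forall>t\<in>{1..s}. price D' (Ind (num t)) = price D (Con (e t)) \<and>
                    price D' (Con {num t}) = price D (Con (e t))) \<and>
        (\<forall>t\<in>{1..s}. \<forall>a\<in>holders D Gen.
           visit D' Gen (num t) a = (if \<exists>i\<in>e t. visit D Gen i a = 1 then 1 else 0)))"

definition consortia_consistency ::
  "'m set \<Rightarrow> 'h set \<Rightarrow> (nat \<Rightarrow> 'm) \<Rightarrow> (('m, 'h) problem \<Rightarrow> 'm \<Rightarrow> real) \<Rightarrow> bool" where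
  "consortia_consistency MM NN num R \<longleftrightarrow>
     (\<forall>D\<in>general_problems MM NN. \<forall>D'\<in>general_problems MM NN. \<forall>e.
        bij_betw e {1..card (consortia D)} (consortia D) \<and> is_reduced num e D D' \<longrightarrow>
        (\<forall>k\<in>{1..card (consortia D)}. (\<Sum>i\<in>e k. R D i) = R D' (num k)))"

definition visited_by :: "('m, 'h) problem \<Rightarrow> 'h \<Rightarrow> 'm set" where
  "visited_by D a = {i \<in> museums D. \<exists>\<sigma>\<in>passes D. a \<in> holders D \<sigma> \<and> visit D \<sigma> i a = 1}"

definition visitors :: "('m, 'h) problem \<Rightarrow> 'm pass \<Rightarrow> 'm \<Rightarrow> 'h set" where
  "visitors D \<sigma> i = {a \<in> holders D \<sigma>. visit D \<sigma> i a = 1}"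

definition consortia_visited_by :: "('m, 'h) problem \<Rightarrow> 'h \<Rightarrow> 'm set set" where
  "consortia_visited_by D a = {Q \<in> consortia D. \<exists>i\<in>Q. visit D Gen i a = 1}"

definition rule_PP :: "('m, 'h) problem \<Rightarrow> 'm \<Rightarrow> real" where
  "rule_PP D i =
     (let Q = consortium_of D i in
        (\<Sum>a\<in>visitors D Gen i.
           price D (Ind i) / (\<Sum>j\<in>visited_by D a \<inter> Q. price D (Ind j))
           * (price D (Con Q) / (\<Sum>S\<in>consortia_visited_by D a. price D (Con S)))
           * price D Gen)
        + (\<Sum>a\<in>visitors D (Con Q) i.
             price D (Ind i) / (\<Sum>j\<in>visited_by D a. price D (Ind j)) * price D (Con Q))
        + real (card (holders D (Ind i))) * price D (Ind i))"

end

theory Submission imports Defs begin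

text \<open>
  An allocation on finite weighted sets that is nonnegative, has a fixed total and is unaffected for
  the others when one member is split is proportional to the weights: merging all other members into
  one shows that a share depends on the own weight only, this dependence is additive, and
  nonnegativity makes it linear.

  By composition and dummy a rule is determined by the problems with a single holder, whose price is
  shared among the visited museums. Splitting museums makes the division inside a consortium
  proportional to the individual prices. For a holder of the general pass the amount going to each
  consortium is found in the reduced problem, where all consortia are singletons: splitting consortia
  there is splitting the members of a weighted set, with the consortium prices as weights.
\<close>

section \<open>Splitting-proof allocations on weighted sets\<close>

text \<open>A split preserves the sum of the prices involved, so the total weight \<open>T\<close>
  is fixed throughout. Additivity is therefore available only for weights between 0 and
  \<open>T\<close>, in lists with sum exactly \<open>T\<close>; the function that expresses a share
  may depend on \<open>T\<close> and on everything else that is held fixed. The two splitting axioms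
  are not equally easy to use. Museums of one consortium can be merged freely. Consortia cannot: a
  split produces copies of a single consortium, so consortia that differ in size or in their pattern
  of visits are never the parts of a common one. Consortia consistency removes this obstacle, since
  in the reduced problem every consortium is one museum and the sums protected by
  splitting-proofness of consortia are single shares.\<close>

text \<open>
  At least two members are required because a museum that forms a consortium alone must charge
  the price of its consortium, so that its weight is not free.
\<close>

definition weighted :: "'m set \<Rightarrow> real \<Rightarrow> 'm set \<Rightarrow> ('m \<Rightarrow> real) \<Rightarrow> bool" where
  "weighted N T S w \<longleftrightarrow>
     finite S \<and> S \<subseteq> N \<and> card S \<ge> 2 \<and> (\<forall>i\<in>S. w i > 0) \<and> sum w S = T"

locale split_proof_allocation =
  fixes N :: "'m set" and \<phi> :: "'m set \<Rightarrow> ('m \<Rightarrow> real) \<Rightarrow> 'm \<Rightarrow> real" and T c :: real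
  assumes infinite_names: "infinite N"
    and nonneg: "weighted N T S w \<Longrightarrow> i \<in> S \<Longrightarrow> \<phi> S w i \<ge> 0"
    and total: "weighted N T S w \<Longrightarrow> (\<Sum>i\<in>S. \<phi> S w i) = c"
    and split: "weighted N T S w \<Longrightarrow> weighted N T S' w' \<Longrightarrow> i \<in> S \<Longrightarrow> I \<noteq> {} \<Longrightarrow>
      I \<inter> (S - {i}) = {} \<Longrightarrow> S' = (S - {i}) \<union> I \<Longrightarrow> (\<And>h. h \<in> S - {i} \<Longrightarrow> w' h = w h) \<Longrightarrow>
      j \<in> S - {i} \<Longrightarrow> \<phi> S' w' j = \<phi> S w j"
begin

definition pair_share :: "'m \<Rightarrow> 'm \<Rightarrow> real \<Rightarrow> real" where
  "pair_share i k x = \<phi> {i, k} (\<lambda>j. if j = i then x else T - x) i"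

lemma weighted_less_total:
  assumes "weighted N T S w" "i \<in> S"
  shows "w i < T"
proof -
  have fin: "finite S" and c2: "card S \<ge> 2" and pos: "\<forall>i\<in>S. w i > 0" and tot: "sum w S = T"
    using assms by (auto simp: weighted_def)
  have "S - {i} \<noteq> {}"
    using c2 card_mono[of "{i}" S] by auto
  then have "0 < sum w (S - {i})" using fin pos by (intro sum_pos) auto
  then show ?thesis using sum.remove[OF fin assms(2), of w] tot by simp
qed

lemma weighted_pair:
  assumes "i \<noteq> k" "i \<in> N" "k \<in> N" "0 < x" "x < T"
  shows "weighted N T {i, k} (\<lambda>j. if j = i then x else T - x)"
  using assms by (auto simp: weighted_def)

text \<open>Everybody except \<open>i\<close> can be merged into the single name \<open>k\<close>.\<close>

lemma share_eq_pair_share: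
  assumes "weighted N T S w" "i \<in> S" "k \<in> N" "k \<noteq> i"
  shows "\<phi> S w i = pair_share i k (w i)"
  unfolding pair_share_def
\<comment> \<open>The assumption is read backwards: \<open>k\<close> is the member that gets split,
  and its parts are all of \<open>S - {i}\<close>, which may contain \<open>k\<close> again.\<close>
proof (rule split[where i = k and I = "S - {i}"])
  have "w i > 0" "i \<in> N" "finite S" "card S \<ge> 2" using assms by (auto simp: weighted_def)
  then show "weighted N T {i, k} (\<lambda>j. if j = i then w i else T - w i)"
    using weighted_less_total[OF assms(1,2)] assms by (intro weighted_pair) auto
  show "S - {i} \<noteq> {}"
    using \<open>card S \<ge> 2\<close> card_mono[of "{i}" S] by auto
qed (use assms in auto)

text \<open>In a pair the two shares add up to \<open>c\<close>, so a share can be computed from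
  that of the partner, whose own partner may be renamed. Passing from \<open>i\<close> to a third
  name \<open>l\<close> and from there to \<open>i0\<close> removes the dependence on the
  name.\<close>

lemma share_eq_function_of_weight:
  obtains F where "\<And>S w i. weighted N T S w \<Longrightarrow> i \<in> S \<Longrightarrow> \<phi> S w i = F (w i)"
proof -
  have fresh: "\<exists>k\<in>N. k \<notin> X" if "finite X" for X
    using infinite_names that by (meson finite_subset subsetI)
  obtain i0 where i0: "i0 \<in> N" using fresh[of "{}"] by auto
  obtain k0 where k0: "k0 \<in> N" "k0 \<noteq> i0" using fresh[of "{i0}"] by auto
  have swap: "pair_share i k x + pair_share k i (T - x) = c"
    if "i \<noteq> k" "i \<in> N" "k \<in> N" "0 < x" "x < T" for i k x
  proof -
    let ?w = "\<lambda>j. if j = i then x else T - x"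
    note w = weighted_pair[OF that]
    have "c = \<phi> {i, k} ?w i + \<phi> {i, k} ?w k"
      using total[OF w] that(1) by simp
    moreover have "\<phi> {i, k} ?w k = pair_share k i (T - x)"
      using share_eq_pair_share[OF w, of k i] that by auto
    ultimately show ?thesis by (simp add: pair_share_def)
  qed
  have other: "pair_share i k x = pair_share i k' x"
    if "i \<noteq> k" "i \<in> N" "k \<in> N" "k' \<in> N" "k' \<noteq> i" "0 < x" "x < T" for i k k' x
    using share_eq_pair_share[OF weighted_pair[OF that(1-3) that(6,7)], of i k'] that(4,5)
    unfolding pair_share_def[of i k] by simp
  have "pair_share i k x = pair_share i0 k0 x"
    if that': "i \<noteq> k" "i \<in> N" "k \<in> N" "0 < x" "x < T" for i k x
  proof -
    obtain l where l: "l \<in> N" "l \<notin> {i, i0}" using fresh[of "{i, i0}"] by auto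
    have "pair_share i k x = pair_share i l x" using that' l by (intro other) auto
    also have "\<dots> = c - pair_share l i (T - x)" using swap[of i l x] that' l by auto
    also have "pair_share l i (T - x) = pair_share l i0 (T - x)" using that' l i0 by (intro other) auto
    also have "c - \<dots> = pair_share i0 l x" using swap[of i0 l x] that' l i0 by auto
    also have "\<dots> = pair_share i0 k0 x" using that' l i0 k0 by (intro other) auto
    finally show ?thesis .
  qed
  note const = this
  have "\<phi> S w i = pair_share i0 k0 (w i)" if "weighted N T S w" "i \<in> S" for S w i
  proof -
    obtain k where "k \<in> N" "k \<noteq> i" using fresh[of "{i}"] by auto
    moreover have "i \<in> N" "w i > 0" using that by (auto simp: weighted_def)
    ultimately show ?thesis
      using share_eq_pair_share[OF that, of k] weighted_less_total[OF that] const[of i k "w i"] by simp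
  qed
  then show ?thesis by (rule that)
qed

text \<open>The additive function \<open>F\<close> is compared with multiples of
  \<open>F (T / n)\<close>, which is \<open>c / n\<close> by symmetry. This yields only a lower
  bound, but the bounds for \<open>x\<close> and \<open>T - x\<close> add up to \<open>c\<close>, as
  do the shares, so both bounds are attained.\<close>

theorem share_proportional:
  assumes "weighted N T S w" "i \<in> S"
  shows "\<phi> S w i = w i / T * c"
proof -
  obtain F where F: "\<And>S w i. weighted N T S w \<Longrightarrow> i \<in> S \<Longrightarrow> \<phi> S w i = F (w i)"
    using share_eq_function_of_weight by blast
  define x where "x = w i"
  have x: "0 < x" "x < T" using assms weighted_less_total by (auto simp: weighted_def x_def)
  \<comment> \<open>Infinitely many names are available, so every such list occurs as the weights of
    a family; lists are used because weights may repeat.\<close>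
  have sumF: "sum_list (map F xs) = c" and nonnegF: "\<forall>y\<in>set xs. F y \<ge> 0"
    if "length xs \<ge> 2" "\<forall>y\<in>set xs. y > 0" "sum_list xs = T" for xs
  proof -
    obtain A where A: "A \<subseteq> N" "finite A" "card A = length xs"
      using infinite_names infinite_arbitrarily_large by metis
    obtain h where h: "bij_betw h A {0..<length xs}"
      using ex_bij_betw_finite_nat[OF A(2)] A(3) by auto
    let ?w = "\<lambda>j. xs ! h j"
    have hA: "h j < length xs" if "j \<in> A" for j using h that by (auto simp: bij_betw_def)
    have re: "(\<Sum>j\<in>A. g (xs ! h j)) = sum_list (map g xs)" for g :: "real \<Rightarrow> real"
      using sum.reindex_bij_betw[OF h, of "\<lambda>l. g (xs ! l)"] by (simp add: sum_list_sum_nth)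
    have wA: "weighted N T A ?w"
      using A hA that re[of "\<lambda>y. y"] by (auto simp: weighted_def)
    have "c = (\<Sum>j\<in>A. F (?w j))" using total[OF wA] F[OF wA] by simp
    then show "sum_list (map F xs) = c" using re by simp
    have "F (?w j) \<ge> 0" if "j \<in> A" for j using nonneg[OF wA that] F[OF wA that] by simp
    moreover have "set xs = (\<lambda>j. xs ! h j) ` A"
    proof -
      have "set xs = (!) xs ` {0..<length xs}" by (auto simp: set_conv_nth)
      also have "{0..<length xs} = h ` A" using h by (simp add: bij_betw_def)
      finally show ?thesis by (simp add: image_image)
    qed
    ultimately show "\<forall>y\<in>set xs. F y \<ge> 0" by auto
  qed
  have lower: "F y \<ge> y / T * c" if y: "0 < y" "y < T" for y
  proof (rule field_le_epsilon)
    fix e :: real assume "e > 0"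
    have c0: "c \<ge> 0" unfolding total[OF assms(1), symmetric] using nonneg[OF assms(1)] by (intro sum_nonneg)
    obtain n0 :: nat where "real n0 > c / e" using reals_Archimedean2 by blast
    \<comment> \<open>\<open>n > c / e\<close> pushes the rounding error \<open>c / n\<close> below
      \<open>e\<close>; \<open>n \<ge> 2\<close> allows \<open>T\<close> to be cut into
      \<open>n\<close> equal weights of one family.\<close>
    then obtain n :: nat where n: "real n > c / e" "n \<ge> 2"
      by (intro that[of "max n0 2"]) auto
    \<comment> \<open>Ceiling minus 1 instead of the floor: the remainder \<open>r\<close> must be a
      positive weight even if \<open>n * y / T\<close> is an integer.\<close>
    define k where "k = nat (\<lceil>n * y / T\<rceil> - 1)"
    have T0: "T > 0" using x by simp
    have "n * y / T > 0" using n y T0 by auto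
    then have k: "real k < n * y / T" "real k \<ge> n * y / T - 1"
      unfolding k_def by linarith+
    define r where "r = y - k * (T / n)"
    have n0: "real n > 0" using n by simp
    have "real k * T < n * y" using k(1) T0 by (simp add: field_simps)
    then have r: "r > 0" unfolding r_def using n0 by (simp add: field_simps)
    have unit: "F (T / n) = c / n"
    proof -
      have "sum_list (map F (replicate n (T / n))) = c"
        using n T0 by (intro sumF) (auto simp: sum_list_replicate)
      then show ?thesis using n0 by (simp add: sum_list_replicate field_simps)
    qed
    \<comment> \<open>Cutting \<open>y\<close> into \<open>k\<close> units and \<open>r\<close>
      gives \<open>F y\<close> as \<open>k\<close> times \<open>c / n\<close> plus
      \<open>F r\<close>, and \<open>F r\<close> is nonnegative.\<close>
    let ?xs = "replicate k (T / n) @ [r, T - y]"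
    have "sum_list (map F ?xs) = c" "\<forall>z\<in>set ?xs. F z \<ge> 0"
      using y T0 n0 r by (intro sumF nonnegF; auto simp: sum_list_replicate r_def)+
    moreover have "sum_list (map F [y, T - y]) = c"
      using y by (intro sumF) auto
    ultimately have "F y \<ge> k * (c / n)" by (simp add: sum_list_replicate unit)
    moreover have "k * (c / n) \<ge> (n * y / T - 1) * (c / n)"
      using k(2) c0 n0 by (intro mult_right_mono) auto
    moreover have "(n * y / T - 1) * (c / n) = y / T * c - c / n"
      using n0 T0 by (simp add: field_simps)
    moreover have "c / n < e" using n n0 \<open>e > 0\<close> by (simp add: field_simps)
    ultimately show "y / T * c \<le> F y + e" by linarith
  qed
  have "sum_list (map F [x, T - x]) = c" using x by (intro sumF) auto
  moreover have "x / T * c + (T - x) / T * c = c" using x by (simp add: field_simps)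
  ultimately have "F x = x / T * c" using lower[of x] lower[of "T - x"] x by simp
  then show ?thesis using F[OF assms] by (simp add: x_def)
qed

end

section \<open>Problems and the proportional-proportional rule\<close>

text \<open>Everything in a problem except holders and visits. Problems that can be composed agree
  in these data, and problems with one holder are built on top of them.\<close>

definition market :: "'m set \<Rightarrow> 'm set \<Rightarrow> 'm set set \<Rightarrow> ('m pass \<Rightarrow> real) \<Rightarrow> bool" where
  "market MM M P pr \<longleftrightarrow>
     finite M \<and> M \<noteq> {} \<and> M \<subseteq> MM \<and> partition_on M P \<and>
     (\<forall>\<sigma>\<in>Ind ` M \<union> {Gen} \<union> Con ` P. pr \<sigma> > 0) \<and>
     (\<forall>\<sigma>. \<sigma> \<notin> Ind ` M \<union> {Gen} \<union> Con ` P \<longrightarrow> pr \<sigma> = 0) \<and>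
     (\<forall>i. {i} \<in> P \<longrightarrow> pr (Ind i) = pr (Con {i}))"

definition single_holder ::
  "'m set \<Rightarrow> 'm set set \<Rightarrow> ('m pass \<Rightarrow> real) \<Rightarrow> 'm pass \<Rightarrow> 'h \<Rightarrow> 'm set \<Rightarrow> ('m, 'h) problem" where
  "single_holder M P pr \<sigma> a V = \<lparr>museums = M, consortia = P,
     holders = (\<lambda>\<tau>. if \<tau> = \<sigma> then {a} else {}), price = pr,
     visit = (\<lambda>\<tau> i b. if \<tau> = \<sigma> \<and> b = a \<and> i \<in> V then 1 else 0)\<rparr>"

lemma single_holder_simps [simp]:
  "museums (single_holder M P pr \<sigma> a V) = M"
  "consortia (single_holder M P pr \<sigma> a V) = P"
  "holders (single_holder M P pr \<sigma> a V) = (\<lambda>\<tau>. if \<tau> = \<sigma> then {a} else {})"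
  "price (single_holder M P pr \<sigma> a V) = pr"
  "visit (single_holder M P pr \<sigma> a V) = (\<lambda>\<tau> i b. if \<tau> = \<sigma> \<and> b = a \<and> i \<in> V then 1 else 0)"
  "passes (single_holder M P pr \<sigma> a V) = Ind ` M \<union> {Gen} \<union> Con ` P"
  by (simp_all add: single_holder_def passes_def)

lemma pass_rows_single_holder:
  "pass_rows (single_holder M P pr \<sigma> a V) \<tau> =
     (case \<tau> of Ind i \<Rightarrow> {i} | Gen \<Rightarrow> M | Con Q \<Rightarrow> Q)"
  by (cases \<tau>) simp_all

lemma single_holder_in_problems:
  assumes "market MM M P pr" "a \<in> NN" "\<sigma> \<in> Ind ` M \<union> {Gen} \<union> Con ` P" "V \<noteq> {}"
    and "V \<subseteq> (case \<sigma> of Ind i \<Rightarrow> {i} | Gen \<Rightarrow> M | Con Q \<Rightarrow> Q)"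
    and "\<And>i. \<sigma> = Ind i \<Longrightarrow> {i} \<notin> P"
  shows "single_holder M P pr \<sigma> a V \<in> problems MM NN"
proof -
  have "visit (single_holder M P pr \<sigma> a V) \<tau> i b = 0"
    if "\<not> (\<tau> \<in> passes (single_holder M P pr \<sigma> a V) \<and> i \<in> pass_rows (single_holder M P pr \<sigma> a V) \<tau>
      \<and> b \<in> holders (single_holder M P pr \<sigma> a V) \<tau>)" for \<tau> i b
    using that assms(3,5) by (auto simp: pass_rows_single_holder)
  moreover have "\<exists>i\<in>pass_rows (single_holder M P pr \<sigma> a V) \<tau>. visit (single_holder M P pr \<sigma> a V) \<tau> i b = 1"
    if "b \<in> holders (single_holder M P pr \<sigma> a V) \<tau>" for \<tau> b
    using that assms(4,5) by (auto simp: pass_rows_single_holder split: if_splits)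
  moreover have "disjoint_family_on (holders (single_holder M P pr \<sigma> a V)) X" for X
    by (simp add: disjoint_family_on_def)
  ultimately show ?thesis
    unfolding problems_def mem_Collect_eq
    using assms(1,2,6) assms(3) by (simp add: market_def) metis
qed

lemma market_of_problem: "D \<in> problems MM NN \<Longrightarrow> market MM (museums D) (consortia D) (price D)"
  by (simp add: problems_def market_def passes_def)

lemma problemsD:
  assumes "D \<in> problems MM NN"
  shows "finite (museums D)" "museums D \<noteq> {}" "museums D \<subseteq> MM"
    "partition_on (museums D) (consortia D)"
    "\<sigma> \<in> passes D \<Longrightarrow> finite (holders D \<sigma>)"
    "\<sigma> \<in> passes D \<Longrightarrow> holders D \<sigma> \<subseteq> NN"
    "\<sigma> \<in> passes D \<Longrightarrow> \<tau> \<in> passes D \<Longrightarrow> \<sigma> \<noteq> \<tau> \<Longrightarrow> holders D \<sigma> \<inter> holders D \<tau> = {}"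
    "\<sigma> \<in> passes D \<Longrightarrow> price D \<sigma> > 0"
    "{i} \<in> consortia D \<Longrightarrow> holders D (Ind i) = {}"
    "{i} \<in> consortia D \<Longrightarrow> price D (Ind i) = price D (Con {i})"
    "\<sigma> \<in> passes D \<Longrightarrow> i \<in> pass_rows D \<sigma> \<Longrightarrow> a \<in> holders D \<sigma> \<Longrightarrow> visit D \<sigma> i a = 0 \<or> visit D \<sigma> i a = 1"
    "\<sigma> \<in> passes D \<Longrightarrow> a \<in> holders D \<sigma> \<Longrightarrow> \<exists>i\<in>pass_rows D \<sigma>. visit D \<sigma> i a = 1"
    "\<sigma> \<notin> passes D \<Longrightarrow> holders D \<sigma> = {}"
    "\<sigma> \<notin> passes D \<Longrightarrow> price D \<sigma> = 0"
    "\<sigma> \<notin> passes D \<or> i \<notin> pass_rows D \<sigma> \<or> a \<notin> holders D \<sigma> \<Longrightarrow> visit D \<sigma> i a = 0"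
  using assms unfolding problems_def mem_Collect_eq disjoint_family_on_def by (elim conjE; simp; fail)+

lemma consortium_unique:
  assumes "partition_on M P" "Q \<in> P" "Q' \<in> P" "i \<in> Q" "i \<in> Q'"
  shows "Q = Q'"
  using assms by (auto simp: partition_on_def disjoint_def)

lemma consortium_of_eq:
  assumes "partition_on (museums D) (consortia D)" "Q \<in> consortia D" "i \<in> Q"
  shows "consortium_of D i = Q"
  unfolding consortium_of_def
  by (rule the_equality) (use assms consortium_unique in \<open>metis+\<close>)

lemma partition_on_obtain:
  assumes "partition_on M P" "i \<in> M"
  obtains Q where "Q \<in> P" "i \<in> Q"
  using assms by (auto simp: partition_on_def)

lemma consortium_of_single_holder:
  assumes "market MM M P pr" "Q \<in> P" "i \<in> Q"
  shows "consortium_of (single_holder M P pr \<sigma> a V) i = Q"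
  using assms by (intro consortium_of_eq) (auto simp: market_def)

text \<open>Holder sets are disjoint, so a holder owns one pass only, and the union over all passes
  in \<open>visited_by\<close> reads a single matrix.\<close>

lemma visited_by_eq:
  assumes "D \<in> problems MM NN" "\<sigma> \<in> passes D" "a \<in> holders D \<sigma>"
  shows "visited_by D a = {i \<in> pass_rows D \<sigma>. visit D \<sigma> i a = 1}"
proof -
  have other: "a \<notin> holders D \<tau>" if "\<tau> \<in> passes D" "\<tau> \<noteq> \<sigma>" for \<tau>
    using problemsD(7)[OF assms(1) that(1) assms(2) that(2)] assms(3) by auto
  have row: "i \<in> pass_rows D \<sigma>" if "visit D \<sigma> i a = 1" for i
    using problemsD(15)[OF assms(1), of \<sigma> i a] that by auto
  have "pass_rows D \<sigma> \<subseteq> museums D"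
    using assms(2) problemsD(4)[OF assms(1)] by (auto simp: passes_def partition_on_def)
  then have "i \<in> museums D" if "visit D \<sigma> i a = 1" for i using row[OF that] by auto
  moreover have "(\<exists>\<tau>\<in>passes D. a \<in> holders D \<tau> \<and> visit D \<tau> i a = 1) \<longleftrightarrow> visit D \<sigma> i a = 1" for i
    using other assms(2,3) by metis
  ultimately show ?thesis unfolding visited_by_def using row by auto
qed

text \<open>The sets of visited museums and consortia become conditions on the column of the holder.
  A summand then depends only on this column, the consortia and the prices, which is the form in
  which additivity over holders and invariance under splits can be checked.\<close>

lemma rule_PP_eq:
  assumes D: "D \<in> problems MM NN" and Q: "Q \<in> consortia D" "i \<in> Q"
  shows "rule_PP D i =
    (\<Sum>a\<in>visitors D Gen i.
       price D (Ind i) / (\<Sum>j | j \<in> Q \<and> visit D Gen j a = 1. price D (Ind j))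
       * (price D (Con Q) / (\<Sum>S | S \<in> consortia D \<and> (\<exists>j\<in>S. visit D Gen j a = 1). price D (Con S)))
       * price D Gen)
    + (\<Sum>a\<in>visitors D (Con Q) i.
         price D (Ind i) / (\<Sum>j | j \<in> Q \<and> visit D (Con Q) j a = 1. price D (Ind j)) * price D (Con Q))
    + real (card (holders D (Ind i))) * price D (Ind i)"
proof -
  have part: "partition_on (museums D) (consortia D)" using D by (auto simp: problems_def)
  then have sub: "Q \<subseteq> museums D" using Q(1) by (auto simp: partition_on_def)
  have mem: "Gen \<in> passes D" "Con Q \<in> passes D" using Q by (auto simp: passes_def)
  have "visited_by D a \<inter> Q = {j. j \<in> Q \<and> visit D Gen j a = 1}" if "a \<in> holders D Gen" for a
    using visited_by_eq[OF D mem(1) that] sub by auto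
  moreover have "visited_by D a = {j. j \<in> Q \<and> visit D (Con Q) j a = 1}" if "a \<in> holders D (Con Q)" for a
    using visited_by_eq[OF D mem(2) that] by auto
  ultimately show ?thesis
    unfolding rule_PP_def Let_def consortium_of_eq[OF part Q] consortia_visited_by_def
    by (intro arg_cong2[where f = "(+)"] sum.cong refl) (simp_all add: visitors_def del: One_nat_def)
qed

section \<open>Composition\<close>

lemma merge_simps [simp]:
  "museums (merge D1 D2) = museums D1" "consortia (merge D1 D2) = consortia D1"
  "price (merge D1 D2) = price D1" "passes (merge D1 D2) = passes D1"
  "holders (merge D1 D2) \<sigma> = holders D1 \<sigma> \<union> holders D2 \<sigma>"
  "visit (merge D1 D2) \<sigma> i a = (if a \<in> holders D1 \<sigma> then visit D1 \<sigma> i a else visit D2 \<sigma> i a)"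
  by (simp_all add: merge_def passes_def)

lemma problemsI:
  assumes "market MM (museums D) (consortia D) (price D)"
    and "\<And>\<sigma>. \<sigma> \<in> passes D \<Longrightarrow> finite (holders D \<sigma>)"
    and "\<And>\<sigma>. \<sigma> \<in> passes D \<Longrightarrow> holders D \<sigma> \<subseteq> NN"
    and "\<And>\<sigma> \<tau>. \<sigma> \<in> passes D \<Longrightarrow> \<tau> \<in> passes D \<Longrightarrow> \<sigma> \<noteq> \<tau> \<Longrightarrow> holders D \<sigma> \<inter> holders D \<tau> = {}"
    and "\<And>i. {i} \<in> consortia D \<Longrightarrow> holders D (Ind i) = {}"
    and "\<And>\<sigma> i a. visit D \<sigma> i a = 0 \<or> visit D \<sigma> i a = 1"
    and "\<And>\<sigma> a. \<sigma> \<in> passes D \<Longrightarrow> a \<in> holders D \<sigma> \<Longrightarrow> \<exists>i\<in>pass_rows D \<sigma>. visit D \<sigma> i a = 1"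
    and "\<And>\<sigma>. \<sigma> \<notin> passes D \<Longrightarrow> holders D \<sigma> = {}"
    and "\<And>\<sigma> i a. \<sigma> \<notin> passes D \<or> i \<notin> pass_rows D \<sigma> \<or> a \<notin> holders D \<sigma> \<Longrightarrow> visit D \<sigma> i a = 0"
  shows "D \<in> problems MM NN"
proof -
  have "(\<forall>\<sigma>\<in>passes D. price D \<sigma> > 0) \<and> (\<forall>\<sigma>. \<sigma> \<notin> passes D \<longrightarrow> price D \<sigma> = 0)"
    using assms(1) unfolding market_def passes_def by blast
  then show ?thesis
    unfolding problems_def mem_Collect_eq disjoint_family_on_def
    using assms(1) by (intro conjI allI ballI impI) (simp_all add: assms(2-9)[simplified] market_def)
qed

lemma visit_0_or_1:
  assumes "D \<in> problems MM NN"
  shows "visit D \<sigma> i a = 0 \<or> visit D \<sigma> i a = 1"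
  using problemsD(11,15)[OF assms] by blast

lemma pass_rows_cong:
  "museums D1 = museums D2 \<Longrightarrow> pass_rows D1 \<sigma> = pass_rows D2 \<sigma>"
  by (cases \<sigma>) simp_all

lemma merge_in_problems:
  assumes D1: "D1 \<in> problems MM NN" and D2: "D2 \<in> problems MM NN"
    and same: "museums D1 = museums D2" "consortia D1 = consortia D2" "price D1 = price D2"
    and disj: "(\<Union>\<sigma>\<in>passes D1. holders D1 \<sigma>) \<inter> (\<Union>\<sigma>\<in>passes D2. holders D2 \<sigma>) = {}"
  shows "merge D1 D2 \<in> problems MM NN"
proof -
  have p: "passes D2 = passes D1" using same by (simp add: passes_def)
  have rows: "pass_rows (merge D1 D2) \<sigma> = pass_rows D1 \<sigma>" "pass_rows D2 \<sigma> = pass_rows D1 \<sigma>" for \<sigma>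
    by (rule pass_rows_cong; simp add: same)+
  note D2' = problemsD[OF D2, unfolded p rows(2)]
  have cross: "holders D1 \<sigma> \<inter> holders D2 \<tau> = {}" if "\<sigma> \<in> passes D1" "\<tau> \<in> passes D1" for \<sigma> \<tau>
    using disj that p by blast
  show ?thesis
  proof (rule problemsI, goal_cases)
    case 1
    show ?case using market_of_problem[OF D1] by simp
  next
    case (4 \<sigma> \<tau>)
    then show ?case
      using problemsD(7)[OF D1, of \<sigma> \<tau>] D2'(7)[of \<sigma> \<tau>] cross[of \<sigma> \<tau>] cross[of \<tau> \<sigma>] by auto
  next
    case (5 i)
    then show ?case using problemsD(9)[OF D1, of i] D2'(9)[of i] same by simp
  next
    case (7 \<sigma> a)
    then show ?case
      using problemsD(12)[OF D1, of \<sigma> a] D2'(12)[of \<sigma> a] unfolding rows(1) by auto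
  next
    case (9 \<sigma> i a)
    then show ?case
      using problemsD(15)[OF D1, of \<sigma> i a] D2'(15)[of \<sigma> i a] unfolding rows(1) by auto
  qed (use problemsD(5,6,13)[OF D1] D2'(5,6,13) visit_0_or_1[OF D1] visit_0_or_1[OF D2]
      in \<open>simp_all add: rows(1)\<close>)
qed

lemma rule_PP_merge:
  assumes D1: "D1 \<in> problems MM NN" and D2: "D2 \<in> problems MM NN"
    and same: "museums D1 = museums D2" "consortia D1 = consortia D2" "price D1 = price D2"
    and disj: "(\<Union>\<sigma>\<in>passes D1. holders D1 \<sigma>) \<inter> (\<Union>\<sigma>\<in>passes D2. holders D2 \<sigma>) = {}"
    and i: "i \<in> museums D1"
  shows "rule_PP (merge D1 D2) i = rule_PP D1 i + rule_PP D2 i"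
proof -
  obtain Q where Q: "Q \<in> consortia D1" "i \<in> Q"
    using partition_on_obtain[OF problemsD(4)[OF D1] i] by blast
  have p: "Gen \<in> passes D1" "Con Q \<in> passes D1" "Ind i \<in> passes D1" "passes D2 = passes D1"
    using Q i same by (auto simp: passes_def)
  have cross: "holders D1 \<sigma> \<inter> holders D2 \<sigma> = {}" if "\<sigma> \<in> passes D1" for \<sigma>
    using disj p that by blast
  have fin: "finite (holders D1 \<sigma>)" "finite (holders D2 \<sigma>)" if "\<sigma> \<in> passes D1" for \<sigma>
    using problemsD(5)[OF D1 that] problemsD(5)[OF D2] that p by auto
  \<comment> \<open>With \<open>f\<close> an arbitrary function of a column, one statement covers
    the sums for the general pass and for the consortium pass.\<close>
  have sum_visitors: "(\<Sum>a\<in>visitors (merge D1 D2) \<sigma> i. f (\<lambda>j. visit (merge D1 D2) \<sigma> j a)) =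
      (\<Sum>a\<in>visitors D1 \<sigma> i. f (\<lambda>j. visit D1 \<sigma> j a)) + (\<Sum>a\<in>visitors D2 \<sigma> i. f (\<lambda>j. visit D2 \<sigma> j a))"
    if s: "\<sigma> \<in> passes D1" for \<sigma> and f :: "('a \<Rightarrow> nat) \<Rightarrow> real"
  proof -
    have "visitors (merge D1 D2) \<sigma> i = visitors D1 \<sigma> i \<union> visitors D2 \<sigma> i"
      using cross[OF s] by (auto simp: visitors_def)
    moreover have "finite (visitors D1 \<sigma> i)" "finite (visitors D2 \<sigma> i)"
      using fin[OF s] by (auto simp: visitors_def)
    moreover have "visitors D1 \<sigma> i \<inter> visitors D2 \<sigma> i = {}"
      using cross[OF s] by (auto simp: visitors_def)
    moreover have "a \<notin> holders D1 \<sigma>" if "a \<in> visitors D2 \<sigma> i" for a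
      using that cross[OF s] by (auto simp: visitors_def)
    ultimately show ?thesis
      by (simp add: sum.union_disjoint) (simp add: visitors_def)
  qed
  note eq1 = rule_PP_eq[OF D1 Q]
  note eq2 = rule_PP_eq[OF D2, folded same, OF Q]
  note eq = rule_PP_eq[OF merge_in_problems[OF D1 D2 same disj], unfolded merge_simps(1-4), OF Q]
  show ?thesis
    unfolding eq eq1 eq2
    using sum_visitors[OF p(1), of "\<lambda>v. price D1 (Ind i) / (\<Sum>j | j \<in> Q \<and> v j = 1. price D1 (Ind j))
       * (price D1 (Con Q) / (\<Sum>S | S \<in> consortia D1 \<and> (\<exists>j\<in>S. v j = 1). price D1 (Con S)))
       * price D1 Gen"]
      sum_visitors[OF p(2), of "\<lambda>v. price D1 (Ind i) / (\<Sum>j | j \<in> Q \<and> v j = 1. price D1 (Ind j)) * price D1 (Con Q)"]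
      card_Un_disjoint[OF fin[OF p(3)] cross[OF p(3)]]
    by (simp only: merge_simps of_nat_add distrib_right)
qed

lemma rule_PP_dummy:
  assumes D: "D \<in> problems MM NN" and i: "i \<in> museums D"
    and "\<forall>\<sigma>\<in>{Ind i, Gen, Con (consortium_of D i)}.
           holders D \<sigma> = {} \<or> (\<forall>a\<in>holders D \<sigma>. visit D \<sigma> i a = 0)"
  shows "rule_PP D i = 0"
proof -
  obtain Q where Q: "Q \<in> consortia D" "i \<in> Q"
    using partition_on_obtain[OF problemsD(4)[OF D] i] by blast
  have c: "consortium_of D i = Q" using consortium_of_eq[OF problemsD(4)[OF D] Q] .
  have "visitors D Gen i = {}" "visitors D (Con Q) i = {}"
    using assms(3) c by (auto simp: visitors_def)
  \<comment> \<open>The matrix of an individual pass has the single row \<open>i\<close>, so each of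
    its holders visits \<open>i\<close>; a dummy museum therefore has none.\<close>
  moreover have "Ind i \<in> passes D" using i by (simp add: passes_def)
  then have "holders D (Ind i) = {}"
    using problemsD(12)[OF D, of "Ind i"] assms(3) by fastforce
  ultimately show ?thesis by (simp add: rule_PP_eq[OF D Q])
qed

text \<open>The third claim is an equality of records, as needed to rewrite the argument of a rule.
  It relies on the default values: the column of \<open>a\<close> vanishes in \<open>D\<close> for
  every pass other than \<open>\<sigma>\<close>, where the merge reads the zeros of
  \<open>D2\<close>. The last claim supplies the decreasing measure for an induction on the number
  of holders.\<close>

lemma remove_holder:
  assumes D: "D \<in> problems MM NN" and s: "\<sigma> \<in> passes D" and a: "a \<in> holders D \<sigma>"
  defines "D1 \<equiv> single_holder (museums D) (consortia D) (price D) \<sigma> a {i. visit D \<sigma> i a = 1}"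
    and "D2 \<equiv> D\<lparr>holders := (\<lambda>\<tau>. holders D \<tau> - {a}),
      visit := (\<lambda>\<tau> i b. if b = a then 0 else visit D \<tau> i b)\<rparr>"
  shows "D1 \<in> problems MM NN" "D2 \<in> problems MM NN" "D = merge D1 D2"
    "(\<Union>\<tau>\<in>passes D1. holders D1 \<tau>) \<inter> (\<Union>\<tau>\<in>passes D2. holders D2 \<tau>) = {}"
    "(\<Union>\<tau>\<in>passes D2. holders D2 \<tau>) = (\<Union>\<tau>\<in>passes D. holders D \<tau>) - {a}"
proof -
  have rows: "(case \<sigma> of Ind i \<Rightarrow> {i} | Gen \<Rightarrow> museums D | Con Q \<Rightarrow> Q) = pass_rows D \<sigma>"
    by (cases \<sigma>) simp_all
  have p2: "passes D2 = passes D" by (simp add: D2_def passes_def)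
  have r2: "pass_rows D2 \<tau> = pass_rows D \<tau>" for \<tau> by (rule pass_rows_cong) (simp add: D2_def)
  have other: "a \<notin> holders D \<tau>" if "\<tau> \<noteq> \<sigma>" for \<tau>
    using problemsD(7)[OF D s, of \<tau>] problemsD(13)[OF D, of \<tau>] that a by (cases "\<tau> \<in> passes D") auto
  show "D1 \<in> problems MM NN"
    unfolding D1_def
  proof (rule single_holder_in_problems)
    show "market MM (museums D) (consortia D) (price D)" using market_of_problem[OF D] .
    show "a \<in> NN" using problemsD(6)[OF D s] a by auto
    show "{i. visit D \<sigma> i a = 1} \<noteq> {}" using problemsD(12)[OF D s a] by auto
    show "{i. visit D \<sigma> i a = 1} \<subseteq> (case \<sigma> of Ind i \<Rightarrow> {i} | Gen \<Rightarrow> museums D | Con Q \<Rightarrow> Q)"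
      unfolding rows by (rule subsetI, rule ccontr) (simp add: problemsD(15)[OF D])
    show "{i} \<notin> consortia D" if "\<sigma> = Ind i" for i using problemsD(9)[OF D, of i] a that by auto
  qed (use s in \<open>simp add: passes_def\<close>)
  show "D2 \<in> problems MM NN"
  proof (rule problemsI, goal_cases)
    case 1
    show ?case using market_of_problem[OF D] by (simp add: D2_def)
  next
    case (4 \<sigma> \<tau>)
    then show ?case using problemsD(7)[OF D, of \<sigma> \<tau>] unfolding p2 by (auto simp: D2_def)
  next
    case (7 \<tau> b)
    then show ?case using problemsD(12)[OF D, of \<tau> b] unfolding p2 r2 by (simp add: D2_def)
  next
    case (9 \<tau> i b)
    then show ?case using problemsD(15)[OF D, of \<tau> i b] unfolding p2 r2 by (auto simp: D2_def)
  qed (use problemsD(5,6,9,13)[OF D] visit_0_or_1[OF D] in \<open>auto simp: D2_def passes_def\<close>)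
  show "D = merge D1 D2"
  proof (rule problem.equality)
    show "holders D = holders (merge D1 D2)"
      using other a by (auto simp: D1_def D2_def fun_eq_iff split: if_splits)
    have "visit D \<tau> i b = visit (merge D1 D2) \<tau> i b" for \<tau> i b
    proof (cases "b = a")
      case True
      then show ?thesis
        using visit_0_or_1[OF D, of \<sigma> i a] other[of \<tau>] problemsD(15)[OF D, of \<tau> i a]
        by (auto simp: D1_def D2_def)
    qed (simp add: D1_def D2_def)
    then show "visit D = visit (merge D1 D2)" by (simp add: fun_eq_iff)
  qed (simp_all add: D1_def D2_def)
  show "(\<Union>\<tau>\<in>passes D1. holders D1 \<tau>) \<inter> (\<Union>\<tau>\<in>passes D2. holders D2 \<tau>) = {}"
    by (auto simp: D1_def D2_def split: if_splits)
  show "(\<Union>\<tau>\<in>passes D2. holders D2 \<tau>) = (\<Union>\<tau>\<in>passes D. holders D \<tau>) - {a}"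
    unfolding p2 by (auto simp: D2_def)
qed

lemma finite_passes: "D \<in> problems MM NN \<Longrightarrow> finite (passes D)"
  using problemsD(1,4)[of D MM NN] finite_elements[of "museums D" "consortia D"]
  by (simp add: passes_def)

text \<open>Induction on the number of holders; when none is left, every museum is a dummy. The two
  maps enter through composition and dummy, so \<open>rule_PP\<close> can be one of them without a
  computation of its total.\<close>

lemma composition_rule_unique:
  assumes R: "composition MM NN R" "dummy MM NN R" and R': "composition MM NN R'" "dummy MM NN R'"
    and single: "\<And>M P pr \<sigma> a V i. single_holder M P pr \<sigma> a V \<in> problems MM NN \<Longrightarrow> i \<in> M \<Longrightarrow>
      R (single_holder M P pr \<sigma> a V) i = R' (single_holder M P pr \<sigma> a V) i"
    and "D \<in> problems MM NN" "i \<in> museums D"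
  shows "R D i = R' D i"
  using assms(6,7)
proof (induction "card (\<Union>\<sigma>\<in>passes D. holders D \<sigma>)" arbitrary: D rule: less_induct)
  case less
  note D = less.prems(1)
  show ?case
  proof (cases "\<exists>\<sigma>\<in>passes D. holders D \<sigma> \<noteq> {}")
    case False
    then have "holders D \<sigma> = {}" for \<sigma> using problemsD(13)[OF D] by blast
    then have "R D i = 0" "R' D i = 0" using R(2) R'(2) less.prems unfolding dummy_def by auto
    then show ?thesis by simp
  next
    case True
    then obtain \<sigma> a where s: "\<sigma> \<in> passes D" "a \<in> holders D \<sigma>" by blast
    define D1 where "D1 = single_holder (museums D) (consortia D) (price D) \<sigma> a {i. visit D \<sigma> i a = 1}"
    define D2 where "D2 = D\<lparr>holders := (\<lambda>\<tau>. holders D \<tau> - {a}),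
      visit := (\<lambda>\<tau> i b. if b = a then 0 else visit D \<tau> i b)\<rparr>"
    note rem = remove_holder[OF D s, folded D1_def D2_def]
    have fin: "finite (\<Union>\<sigma>\<in>passes D. holders D \<sigma>)" (is "finite ?A")
      using finite_passes[OF D] problemsD(5)[OF D] by blast
    have "a \<in> ?A" using s by blast
    then have "card (?A - {a}) < card ?A" by (rule card_Diff1_less[OF fin])
    then have "R D2 i = R' D2 i"
      using less.prems(2) rem(2) by (intro less.hyps) (simp_all add: rem(5), simp add: D2_def)
    moreover have "R D1 i = R' D1 i"
      using rem(1) less.prems(2) unfolding D1_def by (rule single)
    moreover have "museums D1 = museums D2" "consortia D1 = consortia D2" "price D1 = price D2"
      "i \<in> museums D1"
      using less.prems(2) by (simp_all add: D1_def D2_def)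
    then have "R (merge D1 D2) i = R D1 i + R D2 i" "R' (merge D1 D2) i = R' D1 i + R' D2 i"
      using R(1) R'(1) rem(1,2,4) unfolding composition_def by simp_all
    ultimately show ?thesis using rem(3) by simp
  qed
qed

section \<open>Axioms of the proportional-proportional rule\<close>

text \<open>Every denominator of \<open>rule_PP\<close> is the total price of the visited museums of
  a consortium or of the visited consortia. Such a total survives if one element is replaced by
  parts of the same total price that are visited exactly when it was; both kinds of splitting have
  this form.\<close>

lemma sum_split:
  fixes p p' :: "'a \<Rightarrow> real"
  assumes "finite A" "finite I" "i \<in> A" "I \<inter> (A - {i}) = {}"
    and "sum p' I = p i" "\<And>h. h \<in> A - {i} \<Longrightarrow> p' h = p h"
    and "\<And>h. h \<in> I \<Longrightarrow> v' h \<longleftrightarrow> v i" "\<And>h. h \<in> A - {i} \<Longrightarrow> v' h \<longleftrightarrow> v h"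
  shows "(\<Sum>h | h \<in> (A - {i}) \<union> I \<and> v' h. p' h) = (\<Sum>h | h \<in> A \<and> v h. p h)"
proof -
  have "{h. h \<in> (A - {i}) \<union> I \<and> v' h} = {h \<in> A - {i}. v h} \<union> {h \<in> I. v i}"
    using assms by auto
  also have "sum p' \<dots> = (\<Sum>h\<in>{h \<in> A - {i}. v h}. p' h) + (\<Sum>h\<in>{h \<in> I. v i}. p' h)"
    using assms by (intro sum.union_disjoint) auto
  also have "\<dots> = (\<Sum>h\<in>{h \<in> A - {i}. v h}. p h) + (\<Sum>h\<in>{h \<in> {i}. v h}. p h)"
  proof (rule arg_cong2[where f = "(+)"])
    have "{h \<in> {i}. v h} = (if v i then {i} else {})" by auto
    then show "(\<Sum>h\<in>{h \<in> I. v i}. p' h) = (\<Sum>h\<in>{h \<in> {i}. v h}. p h)" using assms(5) by simp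
  qed (use assms(6) in \<open>auto intro: sum.cong\<close>)
  also have "\<dots> = (\<Sum>h\<in>{h \<in> A - {i}. v h} \<union> {h \<in> {i}. v h}. p h)"
    using assms by (intro sum.union_disjoint[symmetric]) auto
  also have "{h \<in> A - {i}. v h} \<union> {h \<in> {i}. v h} = {h. h \<in> A \<and> v h}" using assms by auto
  finally show ?thesis .
qed

text \<open>Apart from the data of the museum itself, a split can affect a share only through the
  denominators. The consortium of \<open>i\<close> may change from \<open>Q\<close> to
  \<open>Q'\<close>, because splitting a fellow museum alters it as a set.\<close>

lemma rule_PP_cong:
  assumes D: "D \<in> problems MM NN" and D': "D' \<in> problems MM NN"
    and Q: "Q \<in> consortia D" "i \<in> Q" and Q': "Q' \<in> consortia D'" "i \<in> Q'"
    and gen: "holders D' Gen = holders D Gen" "price D' Gen = price D Gen"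
      "\<And>a. a \<in> holders D Gen \<Longrightarrow> visit D' Gen i a = visit D Gen i a"
      "\<And>a. a \<in> holders D Gen \<Longrightarrow> (\<Sum>j | j \<in> Q' \<and> visit D' Gen j a = 1. price D' (Ind j)) =
         (\<Sum>j | j \<in> Q \<and> visit D Gen j a = 1. price D (Ind j))"
      "\<And>a. a \<in> holders D Gen \<Longrightarrow>
         (\<Sum>S | S \<in> consortia D' \<and> (\<exists>j\<in>S. visit D' Gen j a = 1). price D' (Con S)) =
         (\<Sum>S | S \<in> consortia D \<and> (\<exists>j\<in>S. visit D Gen j a = 1). price D (Con S))"
    and con: "holders D' (Con Q') = holders D (Con Q)" "price D' (Con Q') = price D (Con Q)"
      "\<And>a. a \<in> holders D (Con Q) \<Longrightarrow> visit D' (Con Q') i a = visit D (Con Q) i a"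
      "\<And>a. a \<in> holders D (Con Q) \<Longrightarrow> (\<Sum>j | j \<in> Q' \<and> visit D' (Con Q') j a = 1. price D' (Ind j)) =
         (\<Sum>j | j \<in> Q \<and> visit D (Con Q) j a = 1. price D (Ind j))"
    and ind: "holders D' (Ind i) = holders D (Ind i)" "price D' (Ind i) = price D (Ind i)"
  shows "rule_PP D' i = rule_PP D i"
proof -
  have "visitors D' Gen i = visitors D Gen i" "visitors D' (Con Q') i = visitors D (Con Q) i"
    using gen con by (auto simp: visitors_def)
  then show ?thesis
    unfolding rule_PP_eq[OF D Q] rule_PP_eq[OF D' Q'] gen(2) con(2) ind
    by (intro arg_cong2[where f = "(+)"] sum.cong refl)
      (simp_all add: gen(4,5) con(4) visitors_def del: One_nat_def)
qed

lemma rule_PP_splits_museum: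
  assumes D: "D \<in> problems MM NN" and D': "D' \<in> problems MM NN"
    and sp: "splits_museum MM D i I D'" and j: "j \<in> museums D - {i}"
  shows "rule_PP D' j = rule_PP D j"
proof -
  note part = problemsD(4)[OF D]
  define Qi where "Qi = consortium_of D i"
  define Qi' where "Qi' = (Qi - {i}) \<union> I"
  note s = sp[unfolded splits_museum_def Let_def, folded Qi_def, folded Qi'_def]
  have iM: "i \<in> museums D" and I: "finite I" "I \<noteq> {}" and IMM: "I \<subseteq> MM - (museums D - {i})"
    and cons: "consortia D' = (consortia D - {Qi}) \<union> {Qi'}"
    and sumI: "(\<Sum>h\<in>I. price D' (Ind h)) = price D (Ind i)"
    and gen: "holders D' Gen = holders D Gen" "price D' Gen = price D Gen"
    and g: "\<forall>a\<in>holders D Gen.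
           (\<forall>h\<in>I. visit D' Gen h a = visit D Gen i a) \<and>
           (\<forall>j\<in>museums D - {i}. visit D' Gen j a = visit D Gen j a)"
    and con: "holders D' (Con Qi') = holders D (Con Qi)" "price D' (Con Qi') = price D (Con Qi)"
    and c: "\<forall>a\<in>holders D (Con Qi).
           (\<forall>h\<in>I. visit D' (Con Qi') h a = visit D (Con Qi) i a) \<and>
           (\<forall>j\<in>Qi - {i}. visit D' (Con Qi') j a = visit D (Con Qi) j a)"
    and ind: "\<forall>h\<in>museums D - {i}. same_pass D D' (Ind h)"
    and oth: "\<forall>S\<in>consortia D - {Qi}. same_pass D D' (Con S)"
    using s by - (elim conjE, assumption)+
  have Idisj: "I \<inter> (museums D - {i}) = {}" using IMM by blast
  have vgen: "visit D' Gen h a = visit D Gen i a" if "a \<in> holders D Gen" "h \<in> I" for a h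
    using g that by simp
  have vgen': "visit D' Gen h a = visit D Gen h a" if "a \<in> holders D Gen" "h \<in> museums D - {i}" for a h
    using g that by simp
  have vcon: "visit D' (Con Qi') h a = visit D (Con Qi) i a" if "a \<in> holders D (Con Qi)" "h \<in> I" for a h
    using c that by simp
  have vcon': "visit D' (Con Qi') h a = visit D (Con Qi) h a"
    if "a \<in> holders D (Con Qi)" "h \<in> Qi - {i}" for a h
    using c that by simp
  obtain Q0 where "Q0 \<in> consortia D" "i \<in> Q0" using partition_on_obtain[OF part iM] .
  then have Qi: "Qi \<in> consortia D" "i \<in> Qi"
    using consortium_of_eq[OF part, of Q0 i] by (auto simp: Qi_def)
  obtain Q where Q: "Q \<in> consortia D" "j \<in> Q" using partition_on_obtain[OF part] j by blast
  have subM: "S \<subseteq> museums D" if "S \<in> consortia D" for S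
    using part that by (auto simp: partition_on_def)
  have finS: "finite S" if "S \<in> consortia D" for S
    using subM[OF that] problemsD(1)[OF D] finite_subset by blast
  have disjQ: "S \<inter> Qi = {}" if "S \<in> consortia D - {Qi}" for S
    using consortium_unique[OF part, of S Qi] that Qi by blast
  have iS: "S \<subseteq> museums D - {i}" if "S \<in> consortia D - {Qi}" for S
    using subM[of S] disjQ[OF that] Qi that by blast
  have dI: "I \<inter> (Qi - {i}) = {}" using Idisj subM[OF Qi(1)] by blast
  define Q' where "Q' = (if Q = Qi then Qi' else Q)"
  have Q': "Q' \<in> consortia D'" "j \<in> Q'" using Q j by (auto simp: Q'_def cons Qi'_def)
  \<comment> \<open>The members of \<open>I\<close> lie in no consortium other than
    \<open>Qi\<close>, so \<open>Qi'\<close> cannot collide with one that is kept. It may equal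
    \<open>Qi\<close>, since \<open>I\<close> may be \<open>{i}\<close>.\<close>
  have Qi'_fresh: "Qi' \<notin> consortia D - {Qi}"
  proof
    assume a: "Qi' \<in> consortia D - {Qi}"
    obtain h where "h \<in> I" using I(2) by blast
    then have "h \<in> museums D - {i}" using iS[OF a] by (auto simp: Qi'_def)
    then show False using Idisj \<open>h \<in> I\<close> by blast
  qed
  have ind_price: "price D' (Ind h) = price D (Ind h)" if "h \<in> museums D - {i}" for h
    using bspec[OF ind that] by (simp add: same_pass_def)
  show ?thesis
  proof (rule rule_PP_cong[OF D D' Q Q' gen])
    show "visit D' Gen j a = visit D Gen j a" if "a \<in> holders D Gen" for a using vgen'[OF that j] .
    show "(\<Sum>j | j \<in> Q' \<and> visit D' Gen j a = 1. price D' (Ind j)) =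
         (\<Sum>j | j \<in> Q \<and> visit D Gen j a = 1. price D (Ind j))" if a: "a \<in> holders D Gen" for a
    proof (cases "Q = Qi")
      case True
      show ?thesis
        unfolding Q'_def True Qi'_def if_True simp_thms
        by (rule sum_split) (use finS Qi I(1) dI sumI ind_price subM[OF Qi(1)] vgen[OF a] vgen'[OF a] in auto)
    next
      case False
      then have sub: "Q \<subseteq> museums D - {i}" using iS Q by blast
      have "visit D' Gen h a = visit D Gen h a" "price D' (Ind h) = price D (Ind h)" if "h \<in> Q" for h
        using vgen'[OF a] ind_price sub that by blast+
      then show ?thesis using False unfolding Q'_def by (intro sum.cong) auto
    qed
    show "(\<Sum>S | S \<in> consortia D' \<and> (\<exists>j\<in>S. visit D' Gen j a = 1). price D' (Con S)) =
         (\<Sum>S | S \<in> consortia D \<and> (\<exists>j\<in>S. visit D Gen j a = 1). price D (Con S))"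
      if a: "a \<in> holders D Gen" for a
      unfolding cons
    proof (rule sum_split)
      show "finite (consortia D)" using finite_elements[OF problemsD(1)[OF D] part] .
      show "{Qi'} \<inter> (consortia D - {Qi}) = {}" using Qi'_fresh by blast
      show "(\<exists>j\<in>h. visit D' Gen j a = 1) = (\<exists>j\<in>Qi. visit D Gen j a = 1)" if "h \<in> {Qi'}" for h
      proof -
        have "(\<exists>j\<in>I. visit D' Gen j a = 1) \<longleftrightarrow> visit D Gen i a = 1"
          using vgen[OF a] I(2) by auto
        moreover have "(\<exists>j\<in>Qi - {i}. visit D' Gen j a = 1) \<longleftrightarrow> (\<exists>j\<in>Qi - {i}. visit D Gen j a = 1)"
          using vgen'[OF a] subM[OF Qi(1)] by (intro bex_cong) auto
        ultimately show ?thesis using that Qi by (auto simp: Qi'_def)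
      qed
      show "(\<exists>j\<in>h. visit D' Gen j a = 1) = (\<exists>j\<in>h. visit D Gen j a = 1)"
        if h: "h \<in> consortia D - {Qi}" for h
        using vgen'[OF a subsetD[OF iS[OF h]]] by (intro bex_cong) auto
    qed (use Qi con oth in \<open>simp_all add: same_pass_def\<close>)
    show "holders D' (Con Q') = holders D (Con Q)" "price D' (Con Q') = price D (Con Q)"
      using con bspec[OF oth, of Q] Q by (auto simp: Q'_def same_pass_def)
    show "visit D' (Con Q') j a = visit D (Con Q) j a" if "a \<in> holders D (Con Q)" for a
      using vcon'[of a j] bspec[OF oth, of Q] Q j that by (auto simp: Q'_def same_pass_def)
    show "(\<Sum>j | j \<in> Q' \<and> visit D' (Con Q') j a = 1. price D' (Ind j)) =
         (\<Sum>j | j \<in> Q \<and> visit D (Con Q) j a = 1. price D (Ind j))" if a: "a \<in> holders D (Con Q)" for a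
    proof (cases "Q = Qi")
      case True
      then have a': "a \<in> holders D (Con Qi)" using a by simp
      have e: "Q' = (Qi - {i}) \<union> I" and e': "Con Q' = Con Qi'"
        using True by (simp_all add: Q'_def Qi'_def)
      show ?thesis
        unfolding e' unfolding True e
        by (rule sum_split) (use finS Qi I(1) dI sumI ind_price subM[OF Qi(1)] vcon[OF a'] vcon'[OF a'] in auto)
    next
      case False
      then have sub: "Q \<subseteq> museums D - {i}" using iS Q by blast
      have "price D' (Ind h) = price D (Ind h)" if "h \<in> Q" for h
        using ind_price sub that by blast
      then show ?thesis
        using False bspec[OF oth, of Q] Q unfolding Q'_def same_pass_def by (intro sum.cong) auto
    qed
    show "holders D' (Ind j) = holders D (Ind j)" "price D' (Ind j) = price D (Ind j)"
      using bspec[OF ind j] by (auto simp: same_pass_def)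
  qed
qed

text \<open>The parts of \<open>K\<close> affect other museums only through the total price of the
  visited consortia, which is preserved. Hence shares outside \<open>K\<close> persist one by one,
  not only in sums over consortia as the axiom asks.\<close>

lemma rule_PP_splits_consortium:
  assumes D: "D \<in> problems MM NN" and D': "D' \<in> problems MM NN"
    and sp: "splits_consortium MM D K t c D'" and Q: "Q \<in> consortia D - {K}" "j \<in> Q"
  shows "rule_PP D' j = rule_PP D j"
proof -
  note part = problemsD(4)[OF D]
  let ?I = "(\<lambda>l. c l ` K) ` {1..t}"
  have K: "K \<in> consortia D" and t: "t \<ge> 1"
    and inj: "inj_on (\<lambda>(l, h). c l h) ({1..t} \<times> K)"
    and f: "\<forall>l\<in>{1..t}. \<forall>h\<in>K. c l h \<in> MM - (museums D - K)"
    and cons: "consortia D' = (consortia D - {K}) \<union> ?I"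
    and sumI: "(\<Sum>l\<in>{1..t}. price D' (Con (c l ` K))) = price D (Con K)"
    and gen: "holders D' Gen = holders D Gen" "price D' Gen = price D Gen"
    and g: "\<forall>a\<in>holders D Gen.
        (\<forall>l\<in>{1..t}. \<forall>h\<in>K. visit D' Gen (c l h) a = visit D Gen h a) \<and>
        (\<forall>j\<in>museums D - K. visit D' Gen j a = visit D Gen j a)"
    and ind: "\<forall>j\<in>museums D - K. same_pass D D' (Ind j)"
    and oth: "\<forall>S\<in>consortia D - {K}. same_pass D D' (Con S)"
    using sp[unfolded splits_consortium_def] by - (elim conjE, assumption)+
  have fresh: "c l h \<notin> museums D - K" if "l \<in> {1..t}" "h \<in> K" for l h using f that by blast
  have vgen: "visit D' Gen (c l h) a = visit D Gen h a"
    if "a \<in> holders D Gen" "l \<in> {1..t}" "h \<in> K" for a l h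
    using g that by simp
  have vgen': "visit D' Gen h a = visit D Gen h a" if "a \<in> holders D Gen" "h \<in> museums D - K" for a h
    using g that by simp
  have Kne: "K \<noteq> {}" using K part by (auto simp: partition_on_def)
  have sub: "S \<subseteq> museums D - K" if "S \<in> consortia D - {K}" for S
  proof -
    have "S \<subseteq> museums D" using part that by (auto simp: partition_on_def)
    then show ?thesis using consortium_unique[OF part, of S K] that K by blast
  qed
  have jM: "j \<in> museums D - K" using sub[OF Q(1)] Q(2) by blast
  have Q0: "Q \<in> consortia D" "Q \<in> consortia D'" using Q by (auto simp: cons)
  have same: "price D' (Ind h) = price D (Ind h)" if "h \<in> Q" for h
    using bspec[OF ind, of h] that sub[OF Q(1)] by (auto simp: same_pass_def)
  have sameQ: "holders D' (Con Q) = holders D (Con Q)" "price D' (Con Q) = price D (Con Q)"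
    "visit D' (Con Q) = visit D (Con Q)"
    using bspec[OF oth Q(1)] by (auto simp: same_pass_def)
  \<comment> \<open>The consortia of \<open>D'\<close> form a set, so the prices can be summed over
    \<open>l\<close> only if different \<open>l\<close> give different images; this uses that
    \<open>K\<close> is nonempty.\<close>
  have copies: "inj_on (\<lambda>l. c l ` K) {1..t}"
  proof (rule inj_onI)
    fix l l' assume l: "l \<in> {1..t}" "l' \<in> {1..t}" "c l ` K = c l' ` K"
    obtain h where h: "h \<in> K" using Kne by blast
    then obtain h' where "h' \<in> K" "c l h = c l' h'" using l(3) by blast
    then show "l = l'" using inj_onD[OF inj, of "(l, h)" "(l', h')"] l h by auto
  qed
  show ?thesis
  proof (rule rule_PP_cong[OF D D' Q0(1) Q(2) Q0(2) Q(2) gen _ _ _ sameQ(1,2)])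
    show "(\<Sum>S | S \<in> consortia D' \<and> (\<exists>j\<in>S. visit D' Gen j a = 1). price D' (Con S)) =
         (\<Sum>S | S \<in> consortia D \<and> (\<exists>j\<in>S. visit D Gen j a = 1). price D (Con S))"
      if a: "a \<in> holders D Gen" for a
      unfolding cons
    proof (rule sum_split)
      show "finite (consortia D)" using finite_elements[OF problemsD(1)[OF D] part] .
      show "?I \<inter> (consortia D - {K}) = {}"
      proof (rule ccontr)
        assume "?I \<inter> (consortia D - {K}) \<noteq> {}"
        then obtain l where l: "l \<in> {1..t}" "c l ` K \<in> consortia D - {K}" by blast
        obtain h where "h \<in> K" using Kne by blast
        then show False using sub[OF l(2)] fresh[OF l(1), of h] by blast
      qed
      show "(\<Sum>S\<in>?I. price D' (Con S)) = price D (Con K)"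
        unfolding sumI[symmetric] using sum.reindex[OF copies] by simp
      show "(\<exists>j\<in>h. visit D' Gen j a = 1) = (\<exists>j\<in>K. visit D Gen j a = 1)" if "h \<in> ?I" for h
        using that vgen[OF a] by auto
      show "(\<exists>j\<in>h. visit D' Gen j a = 1) = (\<exists>j\<in>h. visit D Gen j a = 1)"
        if h: "h \<in> consortia D - {K}" for h
        using vgen'[OF a subsetD[OF sub[OF h]]] by (intro bex_cong) auto
    qed (use K oth in \<open>simp_all add: same_pass_def\<close>)
    show "(\<Sum>j | j \<in> Q \<and> visit D' Gen j a = 1. price D' (Ind j)) =
         (\<Sum>j | j \<in> Q \<and> visit D Gen j a = 1. price D (Ind j))" if a: "a \<in> holders D Gen" for a
    proof -
      have "visit D' Gen h a = visit D Gen h a" if "h \<in> Q" for h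
        using vgen'[OF a] sub[OF Q(1)] that by blast
      then show ?thesis using same by (intro sum.cong) auto
    qed
  qed (use bspec[OF ind jM] vgen'[OF _ jM] same sameQ in \<open>auto simp: same_pass_def\<close>)
qed

lemma Collect_image: "B = f ` A \<Longrightarrow> {y. y \<in> B \<and> Pr y} = f ` {x \<in> A. Pr (f x)}"
  by auto

text \<open>Exchanging the sums isolates one holder. The fractions inside a visited consortium add
  up to 1, which leaves the part \<open>W a\<close> of the general price; in the reduced problem the
  inner fraction belongs to a single museum and is 1.\<close>

lemma rule_PP_reduced:
  assumes D: "D \<in> general_problems MM NN" and D': "D' \<in> general_problems MM NN"
    and num: "inj_on num {1..card (consortia D)}"
    and e: "bij_betw e {1..card (consortia D)} (consortia D)" and red: "is_reduced num e D D'"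
    and k: "k \<in> {1..card (consortia D)}"
  shows "(\<Sum>i\<in>e k. rule_PP D i) = rule_PP D' (num k)"
proof -
  let ?s = "card (consortia D)" and ?Q = "e k"
  have P: "D \<in> problems MM NN" "D' \<in> problems MM NN"
    and hD: "\<And>\<sigma>. \<sigma> \<noteq> Gen \<Longrightarrow> \<sigma> \<in> passes D \<Longrightarrow> holders D \<sigma> = {}"
    using D D' by (auto simp: general_problems_def)
  have hD: "holders D \<sigma> = {}" if "\<sigma> \<noteq> Gen" for \<sigma>
    using hD[OF that] problemsD(13)[OF P(1)] by blast
  have r: "consortia D' = (\<lambda>t. {num t}) ` {1..?s}" "holders D' Gen = holders D Gen"
      "\<And>\<sigma>. \<sigma> \<noteq> Gen \<Longrightarrow> holders D' \<sigma> = {}" "price D' Gen = price D Gen"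
      "\<And>t. t \<in> {1..?s} \<Longrightarrow> price D' (Ind (num t)) = price D (Con (e t))"
      "\<And>t. t \<in> {1..?s} \<Longrightarrow> price D' (Con {num t}) = price D (Con (e t))"
      "\<And>t a. t \<in> {1..?s} \<Longrightarrow> a \<in> holders D Gen \<Longrightarrow>
         visit D' Gen (num t) a = (if \<exists>i\<in>e t. visit D Gen i a = 1 then 1 else 0)"
    using red unfolding is_reduced_def Let_def by simp_all
  have Q: "?Q \<in> consortia D" using e k by (auto simp: bij_betw_def)
  then have pos: "price D (Con ?Q) > 0" using problemsD(8)[OF P(1)] by (simp add: passes_def)
  have Q': "{num k} \<in> consortia D'" using k by (auto simp: r)
  have "?Q \<subseteq> museums D" using Q problemsD(4)[OF P(1)] by (auto simp: partition_on_def)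
  then have finQ: "finite ?Q" and posQ: "\<And>i. i \<in> ?Q \<Longrightarrow> price D (Ind i) > 0"
    using problemsD(1)[OF P(1)] finite_subset problemsD(8)[OF P(1)] by (auto simp: passes_def)
  have finH: "finite (holders D Gen)" using problemsD(5)[OF P(1)] by (simp add: passes_def)
  define W where "W a = price D (Con ?Q) /
    (\<Sum>S | S \<in> consortia D \<and> (\<exists>j\<in>S. visit D Gen j a = 1). price D (Con S)) * price D Gen" for a
  have empty: "visitors X \<sigma> i = {}" if "holders X \<sigma> = {}" for X :: "('a, 'b) problem" and \<sigma> i
    using that by (simp add: visitors_def)
  have "(\<Sum>i\<in>?Q. rule_PP D i) = (\<Sum>i\<in>?Q. \<Sum>a\<in>visitors D Gen i.
      price D (Ind i) / (\<Sum>j | j \<in> ?Q \<and> visit D Gen j a = 1. price D (Ind j)) * W a)"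
    using hD by (intro sum.cong refl) (simp add: rule_PP_eq[OF P(1) Q] empty W_def mult.assoc)
  also have "\<dots> = (\<Sum>i\<in>?Q. \<Sum>a\<in>holders D Gen. if visit D Gen i a = 1 then
      price D (Ind i) / (\<Sum>j | j \<in> ?Q \<and> visit D Gen j a = 1. price D (Ind j)) * W a else 0)"
    by (simp only: visitors_def sum.inter_filter[OF finH])
  also have "\<dots> = (\<Sum>a\<in>holders D Gen. \<Sum>i\<in>?Q. if visit D Gen i a = 1 then
      price D (Ind i) / (\<Sum>j | j \<in> ?Q \<and> visit D Gen j a = 1. price D (Ind j)) * W a else 0)"
    by (rule sum.swap)
  also have "\<dots> = (\<Sum>a\<in>holders D Gen. if \<exists>i\<in>?Q. visit D Gen i a = 1 then W a else 0)"
  proof (rule sum.cong[OF refl])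
    fix a
    let ?V = "{j. j \<in> ?Q \<and> visit D Gen j a = 1}"
    have "(\<Sum>i\<in>?Q. if visit D Gen i a = 1 then price D (Ind i) / (\<Sum>j\<in>?V. price D (Ind j)) * W a else 0)
        = (\<Sum>i\<in>?V. price D (Ind i) / (\<Sum>j\<in>?V. price D (Ind j)) * W a)"
      by (simp only: sum.inter_filter[OF finQ])
    also have "\<dots> = (\<Sum>i\<in>?V. price D (Ind i)) / (\<Sum>j\<in>?V. price D (Ind j)) * W a"
      by (simp only: sum_distrib_right sum_divide_distrib)
    \<comment> \<open>If \<open>a\<close> visits nothing in the consortium, the quotient is 0 / 0,
      which is 0 and agrees with the right-hand side.\<close>
    also have "\<dots> = (if \<exists>i\<in>?Q. visit D Gen i a = 1 then W a else 0)"
    proof (cases "?V = {}")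
      case False
      then have "(\<Sum>i\<in>?V. price D (Ind i)) > 0" using finQ posQ by (intro sum_pos) auto
      then show ?thesis using False by auto
    next
      case True
      then have "\<not> (\<exists>i\<in>?Q. visit D Gen i a = 1)" by blast
      then show ?thesis unfolding True by simp
    qed
    finally show "(\<Sum>i\<in>?Q. if visit D Gen i a = 1 then price D (Ind i) / (\<Sum>j\<in>?V. price D (Ind j)) * W a else 0)
        = (if \<exists>i\<in>?Q. visit D Gen i a = 1 then W a else 0)" .
  qed
  also have "\<dots> = (\<Sum>a\<in>visitors D' Gen (num k). W a)"
  proof -
    have "visitors D' Gen (num k) = {a \<in> holders D Gen. \<exists>i\<in>?Q. visit D Gen i a = 1}"
      unfolding visitors_def r(2) by (rule Collect_cong) (simp add: r(7)[OF k] cong: conj_cong)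
    then show ?thesis by (simp only: sum.inter_filter[OF finH])
  qed
  also have "\<dots> = rule_PP D' (num k)"
    unfolding rule_PP_eq[OF P(2) Q' singletonI]
  proof -
    have sums: "(\<Sum>S | S \<in> consortia D' \<and> (\<exists>j\<in>S. visit D' Gen j a = 1). price D' (Con S)) =
        (\<Sum>S | S \<in> consortia D \<and> (\<exists>j\<in>S. visit D Gen j a = 1). price D (Con S))"
      if a: "a \<in> holders D Gen" for a
    proof -
      let ?T = "{t \<in> {1..?s}. \<exists>i\<in>e t. visit D Gen i a = 1}"
      have v: "visit D' Gen (num t) a = 1 \<longleftrightarrow> (\<exists>i\<in>e t. visit D Gen i a = 1)" if "t \<in> {1..?s}" for t
        unfolding r(7)[OF that a] by simp
      have "{S. S \<in> consortia D' \<and> (\<exists>j\<in>S. visit D' Gen j a = 1)} = (\<lambda>t. {num t}) ` {t \<in> {1..?s}. visit D' Gen (num t) a = 1}"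
        unfolding r(1) by blast
      also have "{t \<in> {1..?s}. visit D' Gen (num t) a = 1} = ?T"
        using v by blast
      finally have "{S. S \<in> consortia D' \<and> (\<exists>j\<in>S. visit D' Gen j a = 1)} = (\<lambda>t. {num t}) ` ?T" .
      moreover have "{S. S \<in> consortia D \<and> (\<exists>j\<in>S. visit D Gen j a = 1)} = e ` ?T"
        by (rule Collect_image[OF bij_betw_imp_surj_on[OF e, symmetric]])
      moreover have "inj_on e ?T" by (rule inj_on_subset[OF bij_betw_imp_inj_on[OF e]]) blast
      \<comment> \<open>Injectivity of \<open>num\<close> keeps the singleton consortia distinct, so
        that no price is lost from the sum over them.\<close>
      moreover have "inj_on (\<lambda>t. {num t}) ?T"
        by (rule inj_onI) (use inj_onD[OF num] in \<open>simp only: singleton_inject mem_Collect_eq\<close>)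
      ultimately show ?thesis by (simp add: sum.reindex r(6) del: One_nat_def)
    qed
    have main: "W a = price D' (Ind (num k)) / (\<Sum>j | j \<in> {num k} \<and> visit D' Gen j a = 1. price D' (Ind j))
        * (price D' (Con {num k}) / (\<Sum>S | S \<in> consortia D' \<and> (\<exists>j\<in>S. visit D' Gen j a = 1). price D' (Con S)))
        * price D' Gen" if a: "a \<in> visitors D' Gen (num k)" for a
    proof -
      have "{j. j \<in> {num k} \<and> visit D' Gen j a = 1} = {num k}" "a \<in> holders D Gen"
        using a by (auto simp: visitors_def r(2))
      then show ?thesis unfolding W_def r(4) using pos by (simp only: sums r(6)[OF k]) (simp add: r(5)[OF k])
    qed
    have e: "visitors D' (Con {num k}) (num k) = {}" "holders D' (Ind (num k)) = {}"
      by (simp_all add: empty r(3))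
    show "(\<Sum>a\<in>visitors D' Gen (num k). W a) =
      (\<Sum>a\<in>visitors D' Gen (num k).
         price D' (Ind (num k)) / (\<Sum>j | j \<in> {num k} \<and> visit D' Gen j a = 1. price D' (Ind j))
         * (price D' (Con {num k}) / (\<Sum>S | S \<in> consortia D' \<and> (\<exists>j\<in>S. visit D' Gen j a = 1). price D' (Con S)))
         * price D' Gen)
      + (\<Sum>a\<in>visitors D' (Con {num k}) (num k).
           price D' (Ind (num k)) / (\<Sum>j | j \<in> {num k} \<and> visit D' (Con {num k}) j a = 1. price D' (Ind j))
             * price D' (Con {num k}))
      + real (card (holders D' (Ind (num k)))) * price D' (Ind (num k))"
      unfolding e sum.empty card.empty of_nat_0 mult_zero_left add_0_right
      by (rule sum.cong[OF refl main])
  qed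
  finally show ?thesis .
qed

section \<open>Problems with a single holder\<close>

lemma revenue_single_holder:
  assumes "finite M" "finite P" "\<sigma> \<in> Ind ` M \<union> {Gen} \<union> Con ` P"
  shows "revenue (single_holder M P pr \<sigma> a V) = pr \<sigma>"
proof -
  have *: "real (card (if b then {a} else {})) * x = (if b then x else 0)" for b and x :: real
    by simp
  show ?thesis
    unfolding revenue_def single_holder_simps *
    using assms by (cases \<sigma>) (auto simp: sum.delta')
qed

text \<open>Gathers the axioms that settle problems with one holder; composition enters afterwards,
  to assemble these.\<close>

locale axiomatic_rule =
  fixes MM :: "'m set" and NN :: "'h set" and num :: "nat \<Rightarrow> 'm"
    and R :: "('m, 'h) problem \<Rightarrow> 'm \<Rightarrow> real"
  assumes infMM: "infinite MM"
    and num: "inj_on num {1..}" "num ` {1..} \<subseteq> MM"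
    and rule: "is_rule MM NN R"
    and dum: "dummy MM NN R"
    and spm: "splitting_proof_museums MM NN R"
    and spc: "splitting_proof_consortia MM NN R"
    and cons: "consortia_consistency MM NN num R"
begin

text \<open>Museums that the only holder does not visit are dummies, so the visited ones share the
  whole revenue, which is the price of one pass.\<close>

lemma sum_visited_single_holder:
  assumes D: "single_holder M P pr \<sigma> a V \<in> problems MM NN" and "V \<subseteq> M"
    and s: "\<sigma> \<in> Ind ` M \<union> {Gen} \<union> Con ` P"
  shows "(\<Sum>i\<in>V. R (single_holder M P pr \<sigma> a V) i) = pr \<sigma>"
proof -
  let ?D = "single_holder M P pr \<sigma> a V"
  have fin: "finite M" and part: "partition_on M P" using problemsD(1,4)[OF D] by auto
  have "(\<Sum>i\<in>V. R ?D i) = (\<Sum>i\<in>M. R ?D i)"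
  proof (rule sum.mono_neutral_left[OF fin \<open>V \<subseteq> M\<close>], rule ballI)
    fix i assume "i \<in> M - V"
    then show "R ?D i = 0" using dum D unfolding dummy_def by simp
  qed
  also have "\<dots> = revenue ?D" using rule D unfolding is_rule_def by fastforce
  also have "\<dots> = pr \<sigma>" using revenue_single_holder[OF fin finite_elements[OF fin part] s] .
  finally show ?thesis .
qed

lemma R_nonneg: "D \<in> problems MM NN \<Longrightarrow> i \<in> museums D \<Longrightarrow> R D i \<ge> 0"
  using rule unfolding is_rule_def by blast

lemma R_unvisited:
  assumes "single_holder M P pr \<sigma> a V \<in> problems MM NN" "i \<in> M - V"
  shows "R (single_holder M P pr \<sigma> a V) i = 0"
  using dum assms unfolding dummy_def by simp

end

section \<open>Dividing the general pass among singleton consortia\<close>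

definition singletons :: "'m set \<Rightarrow> 'm set set" where
  "singletons M = (\<lambda>i. {i}) ` M"

text \<open>One function \<open>x\<close> sets both prices, because a problem requires the
  individual price of a museum to equal the pass price of its singleton consortium.\<close>

definition singleton_price :: "'m set \<Rightarrow> real \<Rightarrow> ('m \<Rightarrow> real) \<Rightarrow> 'm pass \<Rightarrow> real" where
  "singleton_price M g x \<tau> = (case \<tau> of
     Ind j \<Rightarrow> if j \<in> M then x j else 0
   | Gen \<Rightarrow> g
   | Con Q \<Rightarrow> if Q \<in> singletons M then x (the_elem Q) else 0)"

lemma singleton_price_simps [simp]:
  "singleton_price M g x (Ind j) = (if j \<in> M then x j else 0)"
  "singleton_price M g x Gen = g"
  "singleton_price M g x (Con {j}) = (if j \<in> M then x j else 0)"
  by (auto simp: singleton_price_def singletons_def)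

lemma market_singletons:
  assumes "finite M" "M \<noteq> {}" "M \<subseteq> MM" "\<And>i. i \<in> M \<Longrightarrow> x i > 0" "g > 0"
  shows "market MM M (singletons M) (singleton_price M g x)"
proof -
  have "partition_on M (singletons M)"
    by (auto simp: partition_on_def singletons_def disjoint_def)
  moreover have "singleton_price M g x \<tau> = 0" if "\<tau> \<notin> Ind ` M \<union> {Gen} \<union> Con ` singletons M" for \<tau>
    using that by (cases \<tau>) (auto simp: singleton_price_def)
  moreover have "singleton_price M g x \<tau> > 0" if "\<tau> \<in> Ind ` M \<union> {Gen} \<union> Con ` singletons M" for \<tau>
    using that assms(4,5) by (auto simp: singletons_def)
  ultimately show ?thesis
    using assms(1-3) unfolding market_def by (auto simp: singletons_def)
qed

lemma single_general_in_problems: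
  assumes "market MM M P pr" "a \<in> NN" "V \<noteq> {}" "V \<subseteq> M"
  shows "single_holder M P pr Gen a V \<in> general_problems MM NN"
    and "single_holder M P pr Gen a V \<in> problems MM NN"
  using single_holder_in_problems[OF assms(1,2), of Gen V] assms(3,4)
  by (auto simp: general_problems_def)

text \<open>Both families have total \<open>T\<close> and agree off the split member, so the parts
  inherit its weight. This supplies the price condition of the splitting axioms, which the locale
  assumption leaves implicit.\<close>

lemma sum_split_weights:
  assumes "weighted N T S w" "weighted N T S' w'" "i \<in> S" "I \<inter> (S - {i}) = {}"
    "S' = (S - {i}) \<union> I" "\<And>h. h \<in> S - {i} \<Longrightarrow> w' h = w h"
  shows "sum w' I = w i"
proof -
  have fin: "finite S" "finite I" using assms(1,2,5) by (auto simp: weighted_def)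
  have "sum w' S' = sum w' (S - {i}) + sum w' I"
    unfolding assms(5) using fin assms(4) by (intro sum.union_disjoint) auto
  moreover have "sum w' (S - {i}) = sum w (S - {i})" using assms(6) by (intro sum.cong) auto
  moreover have "sum w S = w i + sum w (S - {i})" using fin(1) assms(3) by (rule sum.remove)
  ultimately show ?thesis using assms(1,2) by (simp add: weighted_def)
qed

context axiomatic_rule begin

text \<open>Splitting a consortium that consists of one museum is splitting a member of a weighted
  set. The unvisited museums are held fixed, while the visited ones and their weights vary.\<close>

lemma R_singleton_consortia:
  assumes M: "finite M" "M \<subseteq> MM" and x: "\<And>j. j \<in> M \<Longrightarrow> x j > 0" and g: "g > 0" and a: "a \<in> NN"
    and V: "V \<subseteq> M" "i \<in> V"
  shows "R (single_holder M (singletons M) (singleton_price M g x) Gen a V) i = x i / sum x V * g"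
proof (cases "V = {i}")
  \<comment> \<open>A lone visited museum is below the size required by \<open>weighted\<close>; it
    receives the whole price.\<close>
  case True
  then have "M \<noteq> {}" using V by auto
  then have "single_holder M (singletons M) (singleton_price M g x) Gen a V \<in> problems MM NN"
    using single_general_in_problems(2)[OF market_singletons[of M MM x g] a, of V] M x g V by auto
  then show ?thesis
    using sum_visited_single_holder[of M "singletons M" _ Gen a V] True V x[of i] by auto
next
  case False
  define U where "U = M - V"
  \<comment> \<open>Names of unvisited museums are excluded, so a varying set \<open>S\<close> of
    visited museums never collides with \<open>U\<close>.\<close>
  define N where "N = MM - U"
  define T where "T = sum x V"
  define y where "y S w j = (if j \<in> S then w j else x j)" for S and w :: "'m \<Rightarrow> real" and j
  define fam where "fam S w = single_holder (U \<union> S) (singletons (U \<union> S)) (singleton_price (U \<union> S) g (y S w)) Gen a S"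
    for S w
  have U: "finite U" "U \<subseteq> MM" using M by (auto simp: U_def)
  have fam: "fam S w \<in> problems MM NN" if "weighted N T S w" for S w
    unfolding fam_def
    using that U M x V g a
    by (intro single_general_in_problems(2) market_singletons) (auto simp: weighted_def N_def y_def U_def)
  interpret split_proof_allocation N "\<lambda>S w. R (fam S w)" T g
  proof
    show "infinite N" using infMM U by (simp add: N_def)
  next
    fix S w i assume w: "weighted N T S w" "i \<in> S"
    show "R (fam S w) i \<ge> 0" using w by (intro R_nonneg fam) (auto simp: fam_def)
  next
    fix S w assume w: "weighted N T S w"
    then show "(\<Sum>i\<in>S. R (fam S w) i) = g"
      using sum_visited_single_holder[OF fam[OF w, unfolded fam_def]] by (simp add: fam_def)
  next
    fix S w S' w' i I j
    assume w: "weighted N T S w" "weighted N T S' w'" "i \<in> S" "I \<noteq> {}"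
      "I \<inter> (S - {i}) = {}" "S' = (S - {i}) \<union> I" "\<And>h. h \<in> S - {i} \<Longrightarrow> w' h = w h" "j \<in> S - {i}"
    have I: "finite I" "sum w' I = w i" using w sum_split_weights[OF w(1,2,3,5,6,7)] by (auto simp: weighted_def)
    have SU: "S \<inter> U = {}" "S' \<inter> U = {}" "S' \<subseteq> MM" using w(1,2) by (auto simp: weighted_def N_def)
    obtain e where e: "bij_betw e {1..card I} I" using ex_bij_betw_nat_finite_1[OF I(1)] by blast
    have eI: "e ` {1..card I} = I" and e_in: "\<And>l. l \<in> {1..card I} \<Longrightarrow> e l \<in> I"
      using e by (auto simp: bij_betw_def)
    have pos: "\<And>h. h \<in> I \<Longrightarrow> w' h > 0" using w(2,6) by (auto simp: weighted_def)
    have dI: "I \<inter> (U \<union> S - {i}) = {}" and IMM: "I \<subseteq> MM" using w(5,6) SU by auto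
    have yS: "y S' w' h = y S w h" if "h \<in> (U \<union> S) - {i}" for h
      using that SU w(6,7) by (auto simp: y_def)
    have yI: "y S' w' h = w' h" if "h \<in> I" for h using that w(6) by (simp add: y_def)
    have sumI: "(\<Sum>l\<in>{1..card I}. y S' w' (e l)) = w i"
      using sum.reindex_bij_betw[OF e, of "y S' w'"] yI I(2) by simp
    \<comment> \<open>The \<open>l\<close>-th copy of the only museum in \<open>{i}\<close> is
      \<open>e l\<close>, so the copying map ignores its second argument and there are
      \<open>card I\<close> copies.\<close>
    have "splits_consortium MM (fam S w) {i} (card I) (\<lambda>l h. e l) (fam S' w')"
      unfolding splits_consortium_def
    proof (intro conjI)
      show "card I \<ge> 1" using w(4) I(1) by (simp add: Suc_leI card_gt_0_iff)
      show "inj_on (\<lambda>(l, h). e l) ({1..card I} \<times> {i})"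
        by (auto intro!: inj_onI dest: inj_onD[OF bij_betw_imp_inj_on[OF e]])
      show "\<forall>l\<in>{1..card I}. \<forall>h\<in>{i}. e l \<in> MM - (museums (fam S w) - {i})"
      proof (intro ballI)
        fix l h assume "l \<in> {1..card I}"
        then show "e l \<in> MM - (museums (fam S w) - {i})" using dI IMM e_in by (simp add: fam_def) blast
      qed
      have M': "U \<union> S' = (U \<union> S - {i}) \<union> I" using SU w(3,6) by auto
      then show "museums (fam S' w') = museums (fam S w) - {i} \<union> (\<Union>l\<in>{1..card I}. (\<lambda>h. e l) ` {i})"
        using eI by (auto simp: fam_def)
      have "singletons (U \<union> S') = singletons (U \<union> S) - {{i}} \<union> singletons I"
        unfolding M' by (auto simp: singletons_def)
      then show "consortia (fam S' w') = consortia (fam S w) - {{i}} \<union> (\<lambda>l. (\<lambda>h. e l) ` {i}) ` {1..card I}"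
        using image_image[of "\<lambda>i. {i}" e "{1..card I}"] unfolding eI
        by (simp add: fam_def singletons_def)
      have same_price: "singleton_price (U \<union> S') g (y S' w') (Ind j) = singleton_price (U \<union> S) g (y S w) (Ind j)"
        "singleton_price (U \<union> S') g (y S' w') (Con {j}) = singleton_price (U \<union> S) g (y S w) (Con {j})"
        if "j \<in> U \<union> S - {i}" for j
        using yS[OF that] that M' by auto
      show "\<forall>K\<in>consortia (fam S w) - {{i}}. same_pass (fam S w) (fam S' w') (Con K)"
      proof
        fix K assume "K \<in> consortia (fam S w) - {{i}}"
        then obtain j where "K = {j}" "j \<in> U \<union> S - {i}" by (auto simp: fam_def singletons_def)
        then show "same_pass (fam S w) (fam S' w') (Con K)"
          using same_price[of j] by (simp add: fam_def same_pass_def)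
      qed
      show "\<forall>j\<in>museums (fam S w) - {i}. same_pass (fam S w) (fam S' w') (Ind j)"
        using same_price by (simp add: fam_def same_pass_def)
      show "\<forall>a\<in>holders (fam S w) Gen.
        (\<forall>l\<in>{1..card I}. \<forall>h\<in>{i}. visit (fam S' w') Gen (e l) a = visit (fam S w) Gen h a) \<and>
        (\<forall>j\<in>museums (fam S w) - {i}. visit (fam S' w') Gen j a = visit (fam S w) Gen j a)"
      proof (intro ballI conjI)
        fix b l h assume "b \<in> holders (fam S w) Gen" "l \<in> {1..card I}" "h \<in> {i}"
        then show "visit (fam S' w') Gen (e l) b = visit (fam S w) Gen h b"
          using e_in[of l] w(3,6) by (simp add: fam_def)
      next
        fix b j assume "b \<in> holders (fam S w) Gen" "j \<in> museums (fam S w) - {i}"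
        then show "visit (fam S' w') Gen j b = visit (fam S w) Gen j b"
          using w(6) dI by (auto simp: fam_def)
      qed
      have ee: "e l \<in> U \<union> S'" "y S' w' (e l) > 0" if "l \<in> {1..card I}" for l
        using e_in[OF that] M' yI pos by auto
      \<comment> \<open>Only the general pass has a holder, so the holder sets to be copied are
        empty.\<close>
      show "\<forall>l\<in>{1..card I}. is_copy (fam S w) (Con {i}) (fam S' w') (Con ((\<lambda>h. e l) ` {i})) (\<lambda>h. e l) \<and>
        price (fam S' w') (Con ((\<lambda>h. e l) ` {i})) > 0"
        using ee by (auto simp: fam_def is_copy_def)
      show "\<forall>l\<in>{1..card I}. \<forall>h\<in>{i}. is_copy (fam S w) (Ind h) (fam S' w') (Ind (e l)) (\<lambda>h. e l) \<and>
        price (fam S' w') (Ind (e l)) > 0"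
        using ee by (auto simp: fam_def is_copy_def)
      have yi: "y S w i = w i" using w(3) by (simp add: y_def)
      show "(\<Sum>l\<in>{1..card I}. price (fam S' w') (Con ((\<lambda>h. e l) ` {i}))) = price (fam S w) (Con {i})"
        using ee(1) sumI w(3) yi by (simp add: fam_def)
      show "\<forall>h\<in>{i}. (\<Sum>l\<in>{1..card I}. price (fam S' w') (Ind (e l))) = price (fam S w) (Ind h)"
        using ee(1) sumI w(3) yi by (simp add: fam_def)
    qed (use w(3) in \<open>simp_all add: fam_def singletons_def\<close>)
    moreover have "{i} \<in> consortia (fam S w)" "{j} \<in> consortia (fam S w) - {{i}}"
      using w(3,8) by (auto simp: fam_def singletons_def)
    \<comment> \<open>All consortia being singletons, the sums protected by the axiom have one term
      each.\<close>
    ultimately have "(\<Sum>k\<in>{j}. R (fam S w) k) = (\<Sum>k\<in>{j}. R (fam S' w') k)"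
      using spc fam[OF w(1)] fam[OF w(2)] unfolding splitting_proof_consortia_def by blast
    then show "R (fam S' w') j = R (fam S w) j" by simp
  qed
  have "finite V" using V M finite_subset by blast
  moreover have "card V \<ge> 2"
    using False V \<open>finite V\<close> by (metis One_nat_def Suc_1 Suc_leI card_1_singletonE card_gt_0_iff empty_iff
        le_neq_implies_less singletonD)
  ultimately have "weighted N T V x"
    using M V x by (auto simp: weighted_def N_def U_def T_def)
  from share_proportional[OF this V(2)] have "R (fam V x) i = x i / T * g" .
  \<comment> \<open>At \<open>S = V\<close> and \<open>w = x\<close> the family returns the given
    problem.\<close>
  moreover have "U \<union> V = M" "y V x = x" using V by (auto simp: U_def y_def)
  ultimately show ?thesis by (simp add: fam_def T_def)
qed

text \<open>The reduced problem again has one holder, whose itinerary consists of the numbers of the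
  visited consortia. Its consortia are singletons with the original pass prices, so their shares are
  already known.\<close>

lemma sum_consortium_single_general:
  assumes mk: "market MM M P pr" and a: "a \<in> NN" and V: "V \<noteq> {}" "V \<subseteq> M" and Q: "Q \<in> P" "Q \<inter> V \<noteq> {}"
  shows "(\<Sum>i\<in>Q. R (single_holder M P pr Gen a V) i) =
    pr (Con Q) / (\<Sum>S | S \<in> P \<and> S \<inter> V \<noteq> {}. pr (Con S)) * pr Gen"
proof -
  let ?D = "single_holder M P pr Gen a V"
  have D: "?D \<in> general_problems MM NN" using single_general_in_problems[OF mk a V] by blast
  have part: "partition_on M P" and finM: "finite M" and posP: "\<And>S. S \<in> P \<Longrightarrow> pr (Con S) > 0"
    and posG: "pr Gen > 0"
    using mk by (auto simp: market_def)
  have "finite P" using finite_elements[OF finM part] .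
  then obtain e where e: "bij_betw e {1..card P} P" using ex_bij_betw_nat_finite_1 by blast
  let ?s = "card P"
  define inv where "inv = inv_into {1..?s} num"
  have inj: "inj_on num {1..?s}" using inj_on_subset[OF num(1)] by auto
  have inv: "inv (num t) = t" if "t \<in> {1..?s}" for t
    unfolding inv_def using inv_into_f_f[OF inj that] .
  have "Q \<in> e ` {1..?s}" unfolding bij_betw_imp_surj_on[OF e] by (rule Q(1))
  then obtain k where k: "k \<in> {1..?s}" "e k = Q" by (elim imageE) simp
  \<comment> \<open>The museum \<open>num t\<close> stands for the consortium \<open>e t\<close> and
    must charge its price; \<open>inv\<close> recovers \<open>t\<close> from the museum.\<close>
  define x where "x m = pr (Con (e (inv m)))" for m
  let ?M = "num ` {1..?s}"
  let ?T = "{t \<in> {1..?s}. e t \<inter> V \<noteq> {}}"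
  let ?D' = "single_holder ?M (singletons ?M) (singleton_price ?M (pr Gen) x) Gen a (num ` ?T)"
  have et: "e t \<in> P" if "t \<in> {1..?s}" for t using bij_betwE[OF e] that by blast
  have MMM: "?M \<subseteq> MM" using num(2) by auto
  have xpos: "x m > 0" if "m \<in> ?M" for m using that inv et posP by (auto simp: x_def)
  have kT: "k \<in> ?T" using k Q(2) by auto
  have "market MM ?M (singletons ?M) (singleton_price ?M (pr Gen) x)"
    using MMM xpos posG k(1) by (intro market_singletons) auto
  then have D': "?D' \<in> general_problems MM NN"
    using single_general_in_problems(1)[OF _ a, of _ ?M _ _ "num ` ?T"] kT by blast
  have red: "is_reduced num e ?D ?D'"
    unfolding is_reduced_def Let_def single_holder_simps
  proof (intro conjI ballI)
    fix t b assume t: "t \<in> {1..?s}" and b: "b \<in> (if Gen = Gen then {a} else {})"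
    have "num t \<in> num ` ?T \<longleftrightarrow> t \<in> ?T" using inj_on_image_mem_iff[OF inj t, of ?T] by blast
    then show "(if Gen = Gen \<and> b = a \<and> num t \<in> num ` ?T then 1 else 0) =
        (if \<exists>i\<in>e t. (if Gen = Gen \<and> b = a \<and> i \<in> V then 1 else 0) = (1::nat) then 1 else (0::nat))"
      using t b by auto
  qed (auto simp: singletons_def x_def inv)
  have "(\<Sum>i\<in>e k. R ?D i) = R ?D' (num k)"
    by (rule cons[unfolded consortia_consistency_def, rule_format, OF D D' conjI, OF _ red])
      (unfold single_holder_simps, fact e, fact k(1))
  also have "\<dots> = x (num k) / sum x (num ` ?T) * pr Gen"
    using MMM xpos posG a kT by (intro R_singleton_consortia) auto
  also have "sum x (num ` ?T) = (\<Sum>t\<in>?T. pr (Con (e t)))"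
    using inv by (subst sum.reindex) (auto intro: inj_on_subset[OF inj] simp: x_def)
  also have "\<dots> = (\<Sum>S\<in>e ` ?T. pr (Con S))"
    by (subst sum.reindex) (auto intro: inj_on_subset[OF bij_betw_imp_inj_on[OF e]])
  also have "e ` ?T = {S. S \<in> P \<and> S \<inter> V \<noteq> {}}"
    using Collect_image[OF bij_betw_imp_surj_on[OF e, symmetric], of "\<lambda>S. S \<inter> V \<noteq> {}"] by simp
  finally show ?thesis using k inv[OF k(1)] by (simp add: x_def)
qed

end

section \<open>Division inside a consortium\<close>

definition consortium_share ::
  "'m set set \<Rightarrow> ('m pass \<Rightarrow> real) \<Rightarrow> 'm pass \<Rightarrow> 'm set \<Rightarrow> 'm set \<Rightarrow> real" where
  "consortium_share P pr \<sigma> V Q =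
     (if \<sigma> = Gen then pr (Con Q) / (\<Sum>S | S \<in> P \<and> S \<inter> V \<noteq> {}. pr (Con S)) * pr Gen else pr \<sigma>)"

lemma single_in_problems:
  assumes "market MM M P pr" "a \<in> NN" "Q \<in> P" "Q \<inter> V \<noteq> {}"
    and "\<sigma> = Gen \<and> V \<subseteq> M \<or> \<sigma> = Con Q \<and> V \<subseteq> Q"
  shows "single_holder M P pr \<sigma> a V \<in> problems MM NN"
  using assms by (intro single_holder_in_problems) auto

context axiomatic_rule begin

text \<open>The general pass and the pass of \<open>Q\<close> differ only in the amount that reaches
  \<open>Q\<close>. Isolating it as \<open>consortium_share\<close> lets one argument treat both
  passes.\<close>

lemma sum_visited_in_consortium:
  assumes mk: "market MM M P pr" and a: "a \<in> NN" and Q: "Q \<in> P" "Q \<inter> V \<noteq> {}"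
    and s: "\<sigma> = Gen \<and> V \<subseteq> M \<or> \<sigma> = Con Q \<and> V \<subseteq> Q"
  shows "(\<Sum>i\<in>Q \<inter> V. R (single_holder M P pr \<sigma> a V) i) = consortium_share P pr \<sigma> V Q"
proof -
  let ?D = "single_holder M P pr \<sigma> a V"
  have D: "?D \<in> problems MM NN" using single_in_problems[OF assms] .
  have sub: "Q \<subseteq> M" "finite Q" using mk Q(1) by (auto simp: market_def partition_on_def intro: finite_subset)
  have "(\<Sum>i\<in>Q \<inter> V. R ?D i) = (\<Sum>i\<in>Q. R ?D i)"
    using sub R_unvisited[OF D] by (intro sum.mono_neutral_left) auto
  moreover have "Q \<inter> V = V" if "\<sigma> = Con Q" using s that by auto
  moreover have "(\<Sum>i\<in>Q. R ?D i) = consortium_share P pr Gen V Q" if "\<sigma> = Gen"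
    using sum_consortium_single_general[OF mk a _ _ Q] s that Q(2) by (auto simp: consortium_share_def)
  moreover have "(\<Sum>i\<in>V. R ?D i) = pr \<sigma>" if "\<sigma> = Con Q"
    using sum_visited_single_holder[OF D] s that Q(1) sub by auto
  ultimately show ?thesis using s by (auto simp: consortium_share_def)
qed

text \<open>Splitting a museum changes neither the pass price of its consortium nor which consortia
  are visited. The amount reaching \<open>Q\<close> is thus a constant, divided among the museums of
  \<open>Q\<close> on the itinerary with their individual prices as weights.\<close>

lemma R_within_consortium:
  assumes mk: "market MM M P pr" and a: "a \<in> NN" and Q: "Q \<in> P"
    and s: "\<sigma> = Gen \<and> V \<subseteq> M \<or> \<sigma> = Con Q \<and> V \<subseteq> Q" and i: "i \<in> Q \<inter> V"
  shows "R (single_holder M P pr \<sigma> a V) i =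
    pr (Ind i) / (\<Sum>j\<in>Q \<inter> V. pr (Ind j)) * consortium_share P pr \<sigma> V Q"
proof (cases "Q \<inter> V = {i}")
  case True
  have "i \<in> M" using mk i Q by (auto simp: market_def partition_on_def)
  then have "pr (Ind i) > 0" using mk by (auto simp: market_def)
  then show ?thesis using sum_visited_in_consortium[OF mk a Q _ s] True by simp
next
  case False
  \<comment> \<open>\<open>S0\<close> will be replaced by a variable set \<open>S\<close>. Kept
    fixed are the unvisited museums \<open>B\<close> of \<open>Q\<close>, the visited museums
    \<open>W\<close> outside \<open>Q\<close>, and altogether all museums \<open>U\<close> not in
    \<open>S0\<close>.\<close>
  define S0 where "S0 = Q \<inter> V"
  define U where "U = M - S0"
  define B where "B = Q - S0"
  define W where "W = V - S0"
  define N where "N = MM - U"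
  define T where "T = (\<Sum>j\<in>S0. pr (Ind j))"
  define c where "c = consortium_share P pr \<sigma> V Q"
  define price' where "price' S w \<tau> = (case \<tau> of
      Ind j \<Rightarrow> if j \<in> S then w j else if j \<in> U then pr (Ind j) else 0
    | Gen \<Rightarrow> pr Gen
    | Con K \<Rightarrow> if K = B \<union> S then pr (Con Q) else if K \<in> P - {Q} then pr (Con K) else 0)" for S w \<tau>
  \<comment> \<open>A consortium is identified with its set of museums, so the index of the pass of
    \<open>Q\<close> moves with \<open>S\<close>.\<close>
  define pass' where "pass' S = (if \<sigma> = Gen then Gen else Con (B \<union> S))" for S
  define fam where "fam S w = single_holder (U \<union> S) (insert (B \<union> S) (P - {Q})) (price' S w) (pass' S) a (W \<union> S)"
    for S w
  have part: "partition_on M P" and finM: "finite M" and MMM: "M \<subseteq> MM"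
    and posI: "\<And>j. j \<in> M \<Longrightarrow> pr (Ind j) > 0" and posC: "\<And>K. K \<in> P \<Longrightarrow> pr (Con K) > 0"
    and posG: "pr Gen > 0"
    and zero: "\<And>\<tau>. \<tau> \<notin> Ind ` M \<union> {Gen} \<union> Con ` P \<Longrightarrow> pr \<tau> = 0"
    and sing: "\<And>j. {j} \<in> P \<Longrightarrow> pr (Ind j) = pr (Con {j})"
    using mk unfolding market_def by blast+
  have QM: "Q \<subseteq> M" using part Q by (auto simp: partition_on_def)
  have VM: "V \<subseteq> M" using s QM by auto
  have KQ: "K \<inter> Q = {}" "K \<subseteq> M" "K \<noteq> {}" if "K \<in> P - {Q}" for K
    using part Q that by (auto simp: partition_on_def disjoint_def)
  have KU: "K \<subseteq> U" "K \<inter> B = {}" if "K \<in> P - {Q}" for K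
    using KQ[OF that] by (auto simp: U_def S0_def B_def)
  have BU: "B \<subseteq> U" "W \<subseteq> U" "W \<inter> B = {}" "U \<subseteq> MM" "finite U"
    using QM VM MMM finM by (auto simp: B_def U_def W_def S0_def)
  have UB: "U - B = M - Q" by (auto simp: U_def B_def S0_def)
  have st: "finite S" "S \<noteq> {}" "S \<inter> U = {}" "S \<subseteq> MM" "\<And>j. j \<in> S \<Longrightarrow> w j > 0" "card (B \<union> S) \<ge> 2"
    if "weighted N T S w" for S w
  proof -
    show fin: "finite S" and "S \<noteq> {}" "S \<inter> U = {}" "S \<subseteq> MM" "\<And>j. j \<in> S \<Longrightarrow> w j > 0"
      using that by (auto simp: weighted_def N_def)
    have "finite (B \<union> S)" using fin BU finite_subset by auto
    then show "card (B \<union> S) \<ge> 2"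
      using card_mono[of "B \<union> S" S] that by (auto simp: weighted_def)
  qed
  \<comment> \<open>\<open>S\<close> is nonempty and disjoint from \<open>U\<close>, which contains
    all the other consortia; hence the first test for consortia in \<open>price'\<close> overrides
    none of their prices.\<close>
  have freshQ: "B \<union> S \<notin> P - {Q}" if "weighted N T S w" for S w
    using st(2,3)[OF that] KU(1)[of "B \<union> S"] by blast
  have mk': "market MM (U \<union> S) (insert (B \<union> S) (P - {Q})) (price' S w)" if w: "weighted N T S w" for S w
    unfolding market_def
  proof (intro conjI allI ballI impI)
    note S = st[OF w]
    show "finite (U \<union> S)" "U \<union> S \<noteq> {}" "U \<union> S \<subseteq> MM" using S BU by auto
    have "\<Union> (P - {Q}) = M - Q" using part KQ(1) Q by (auto simp: partition_on_def)
    then have "\<Union> (insert (B \<union> S) (P - {Q})) = U \<union> S" using UB BU(1) by auto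
    moreover have "disjoint (P - {Q})" using part by (auto simp: partition_on_def disjoint_def)
    moreover have "K \<inter> (B \<union> S) = {}" if "K \<in> P - {Q}" for K using KU[OF that] S(3) by blast
    ultimately show "partition_on (U \<union> S) (insert (B \<union> S) (P - {Q}))"
      using part S(2) by (auto simp: partition_on_def pairwise_insert disjnt_def disjoint_def)
    show "price' S w \<tau> > 0" if "\<tau> \<in> Ind ` (U \<union> S) \<union> {Gen} \<union> Con ` insert (B \<union> S) (P - {Q})" for \<tau>
    proof (cases \<tau>)
      case (Ind j)
      then show ?thesis using that S(5)[of j] posI[of j] by (auto simp: price'_def U_def)
    next
      case (Con K)
      then show ?thesis using that posC[of K] posC[OF Q] by (simp add: price'_def image_iff) blast
    qed (simp add: price'_def posG)
    show "price' S w \<tau> = 0" if "\<tau> \<notin> Ind ` (U \<union> S) \<union> {Gen} \<union> Con ` insert (B \<union> S) (P - {Q})" for \<tau>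
      using that by (cases \<tau>) (auto simp: price'_def)
    show "price' S w (Ind j) = price' S w (Con {j})" if "{j} \<in> insert (B \<union> S) (P - {Q})" for j
    proof -
      \<comment> \<open>Here the bound on \<open>card S\<close> is used: the consortium containing
        \<open>S\<close> is not a singleton, so its pass price puts no constraint on the
        weights.\<close>
      have "{j} \<noteq> B \<union> S" using S(6) by (metis card.empty card_insert_disjoint finite.emptyI empty_iff Suc_1 One_nat_def Suc_n_not_le_n)
      then have "{j} \<in> P - {Q}" using that by auto
      moreover have "j \<in> U" "j \<notin> S" using KU(1)[OF calculation] S(3) by auto
      ultimately show ?thesis using sing[of j] \<open>{j} \<noteq> B \<union> S\<close> by (simp add: price'_def)
    qed
  qed
  have pass': "pass' S = Gen \<and> W \<union> S \<subseteq> U \<union> S \<or> pass' S = Con (B \<union> S) \<and> W \<union> S \<subseteq> B \<union> S" for S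
    using s BU by (auto simp: pass'_def W_def S0_def)
  have BS: "(B \<union> S) \<inter> (W \<union> S) = S" for S using BU(3) by auto
  have fam: "fam S w \<in> problems MM NN" if w: "weighted N T S w" for S w
    unfolding fam_def using st(2)[OF w] BS[of S]
    by (intro single_in_problems[OF mk'[OF w] a _ _ pass']) auto
  \<comment> \<open>\<open>B \<union> S\<close> takes the place of \<open>Q\<close> at the same
    price and the other visited consortia are the same, so the denominator depends neither on
    \<open>S\<close> nor on \<open>w\<close>.\<close>
  have share: "consortium_share (insert (B \<union> S) (P - {Q})) (price' S w) (pass' S) (W \<union> S) (B \<union> S) = c"
    if w: "weighted N T S w" for S w
  proof (cases "\<sigma> = Gen")
    case True
    note S = st[OF w]
    let ?X = "{K \<in> P - {Q}. K \<inter> V \<noteq> {}}"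
    have "finite ?X" using finite_elements[OF finM part] by auto
    have "K \<inter> (W \<union> S) = K \<inter> V" if "K \<in> P - {Q}" for K
      using KU[OF that] KQ[OF that] S(3) by (auto simp: W_def S0_def)
    then have 1: "{K. K \<in> insert (B \<union> S) (P - {Q}) \<and> K \<inter> (W \<union> S) \<noteq> {}} = insert (B \<union> S) ?X"
      using BS[of S] S(2) by auto
    have 2: "{K. K \<in> P \<and> K \<inter> V \<noteq> {}} = insert Q ?X" using Q i by auto
    have "price' S w (Con K) = pr (Con K)" if "K \<in> ?X" for K
      using that freshQ[OF w] by (auto simp: price'_def)
    then have "(\<Sum>K\<in>?X. price' S w (Con K)) = (\<Sum>K\<in>?X. pr (Con K))" by (rule sum.cong[OF refl])
    moreover have "price' S w (Con (B \<union> S)) = pr (Con Q)" "price' S w Gen = pr Gen"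
      by (simp_all add: price'_def)
    moreover have "B \<union> S \<notin> ?X" using freshQ[OF w] by blast
    ultimately show ?thesis
      unfolding consortium_share_def c_def 1 2 using True \<open>finite ?X\<close> by (simp add: pass'_def)
  next
    case False
    then show ?thesis using s by (simp add: consortium_share_def c_def pass'_def price'_def)
  qed
  interpret split_proof_allocation N "\<lambda>S w. R (fam S w)" T c
  proof
    show "infinite N" using infMM BU by (simp add: N_def)
  next
    fix S w j assume w: "weighted N T S w" "j \<in> S"
    then show "R (fam S w) j \<ge> 0" by (intro R_nonneg fam) (auto simp: fam_def)
  next
    fix S w assume w: "weighted N T S w"
    show "(\<Sum>j\<in>S. R (fam S w) j) = c"
      using sum_visited_in_consortium[OF mk'[OF w] a insertI1 _ pass'] st(2)[OF w]
      unfolding BS share[OF w] fam_def by simp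
  next
    fix S w S' w' k I j
    assume w: "weighted N T S w" "weighted N T S' w'" "k \<in> S" "I \<noteq> {}"
      "I \<inter> (S - {k}) = {}" "S' = (S - {k}) \<union> I" "\<And>h. h \<in> S - {k} \<Longrightarrow> w' h = w h" "j \<in> S - {k}"
    have I: "finite I" "sum w' I = w k" using w sum_split_weights[OF w(1,2,3,5,6,7)] by (auto simp: weighted_def)
    note S = st[OF w(1)] and S' = st[OF w(2)]
    have kU: "k \<notin> U" "k \<notin> B" "k \<notin> W" using w(3) S(3) BU by auto
    have IU: "I \<inter> U = {}" "I \<subseteq> MM" "\<And>h. h \<in> I \<Longrightarrow> w' h > 0" using S'(3-5) w(6) by auto
    have co: "consortium_of (fam S w) k = B \<union> S"
      unfolding fam_def using w(3) by (intro consortium_of_single_holder[OF mk'[OF w(1)]]) auto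
    have QQ: "B \<union> S - {k} \<union> I = B \<union> S'" using kU w(6) by auto
    have pI: "price' S' w' (Ind h) = w' h" if "h \<in> I" for h
      using that w(6) by (simp add: price'_def)
    have pS: "price' S' w' (Ind h) = price' S w (Ind h)" if "h \<in> U \<union> S - {k}" for h
      using that w(6,7) IU(1) by (auto simp: price'_def)
    have pK: "price' S' w' (Con K) = price' S w (Con K)" if "K \<in> P - {Q}" for K
      using that freshQ[OF w(1)] freshQ[OF w(2)] by (auto simp: price'_def)
    have vis: "h \<in> W \<union> S' \<longleftrightarrow> k \<in> W \<union> S" if "h \<in> I" for h using that w(3,6) by auto
    have vis': "h \<in> W \<union> S' \<longleftrightarrow> h \<in> W \<union> S" if "h \<in> U \<union> S - {k}" for h
      using that w(6) IU(1) BU(2) by auto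
    have MM': "U \<union> S' = U \<union> S - {k} \<union> I" using kU w(6) by auto
    have PP': "insert (B \<union> S') (P - {Q}) = insert (B \<union> S) (P - {Q}) - {B \<union> S} \<union> {B \<union> S'}"
      using freshQ[OF w(1)] by auto
    have "splits_museum MM (fam S w) k I (fam S' w')"
      unfolding splits_museum_def Let_def co QQ
    proof (intro conjI)
      show "I \<subseteq> MM - (museums (fam S w) - {k})" using IU w(5) by (auto simp: fam_def)
      show "museums (fam S' w') = museums (fam S w) - {k} \<union> I" using MM' by (simp add: fam_def)
      show "consortia (fam S' w') = consortia (fam S w) - {B \<union> S} \<union> {B \<union> S'}"
        using PP' by (simp add: fam_def)
      show "\<forall>h\<in>I. is_copy (fam S w) (Ind k) (fam S' w') (Ind h) (\<lambda>_. h) \<and> price (fam S' w') (Ind h) > 0"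
        using pI IU(3) by (auto simp: fam_def is_copy_def pass'_def)
      show "(\<Sum>h\<in>I. price (fam S' w') (Ind h)) = price (fam S w) (Ind k)"
        using pI I(2) w(3) by (simp add: fam_def price'_def)
      show "\<forall>b\<in>holders (fam S w) Gen.
           (\<forall>h\<in>I. visit (fam S' w') Gen h b = visit (fam S w) Gen k b) \<and>
           (\<forall>j\<in>museums (fam S w) - {k}. visit (fam S' w') Gen j b = visit (fam S w) Gen j b)"
        using vis vis' by (auto simp: fam_def pass'_def)
      show "\<forall>b\<in>holders (fam S w) (Con (B \<union> S)).
           (\<forall>h\<in>I. visit (fam S' w') (Con (B \<union> S')) h b = visit (fam S w) (Con (B \<union> S)) k b) \<and>
           (\<forall>j\<in>B \<union> S - {k}. visit (fam S' w') (Con (B \<union> S')) j b = visit (fam S w) (Con (B \<union> S)) j b)"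
        using vis vis' BU(1) by (auto simp: fam_def pass'_def)
      show "\<forall>h\<in>museums (fam S w) - {k}. same_pass (fam S w) (fam S' w') (Ind h)"
        using pS by (simp add: fam_def same_pass_def pass'_def)
      show "\<forall>K\<in>consortia (fam S w) - {B \<union> S}. same_pass (fam S w) (fam S' w') (Con K)"
      proof
        fix K assume "K \<in> consortia (fam S w) - {B \<union> S}"
        then have K: "K \<in> P - {Q}" by (auto simp: fam_def)
        then have "K \<noteq> B \<union> S" "K \<noteq> B \<union> S'" using freshQ[OF w(1)] freshQ[OF w(2)] by blast+
        then show "same_pass (fam S w) (fam S' w') (Con K)"
          using pK[OF K] by (simp add: fam_def same_pass_def pass'_def)
      qed
    qed (use w(3,4) I(1) in \<open>simp_all add: fam_def price'_def pass'_def\<close>)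
    moreover have "k \<in> museums (fam S w)" "j \<in> museums (fam S w) - {k}" using w(3,8) by (auto simp: fam_def)
    ultimately have "R (fam S w) j = R (fam S' w') j"
      using spm fam[OF w(1)] fam[OF w(2)] unfolding splitting_proof_museums_def by blast
    then show "R (fam S' w') j = R (fam S w) j" by simp
  qed
  have "finite S0" using finM QM finite_subset by (auto simp: S0_def)
  moreover have "card S0 \<ge> 2"
  proof (rule ccontr)
    assume "\<not> card S0 \<ge> 2"
    then have "card S0 \<le> Suc 0" by simp
    then have "S0 = {i}" using \<open>finite S0\<close> i by (auto simp: card_le_Suc0_iff_eq S0_def)
    then show False using False by (simp add: S0_def)
  qed
  ultimately have w0: "weighted N T S0 (\<lambda>j. pr (Ind j))"
    using MMM QM posI by (auto simp: weighted_def N_def U_def T_def S0_def)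
  have "R (fam S0 (\<lambda>j. pr (Ind j))) i = pr (Ind i) / T * c"
    using share_proportional[OF w0] i by (simp add: S0_def)
  moreover have sets: "U \<union> S0 = M" "B \<union> S0 = Q" "W \<union> S0 = V"
    using QM by (auto simp: U_def B_def W_def S0_def)
  \<comment> \<open>The default value 0 matters here: off the index set both price families vanish,
    so at \<open>S0\<close> the family returns the given problem as a record, to which
    \<open>R\<close> is applied.\<close>
  moreover have "price' S0 (\<lambda>j. pr (Ind j)) \<tau> = pr \<tau>" for \<tau>
  proof (cases \<tau>)
    case (Ind j)
    then show ?thesis using zero[of "Ind j"] sets(1) by (auto simp: price'_def)
  next
    case (Con K)
    then show ?thesis using zero[of "Con K"] sets(2) by (auto simp: price'_def)
  qed (simp add: price'_def)
  then have "price' S0 (\<lambda>j. pr (Ind j)) = pr" by (simp add: fun_eq_iff)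
  moreover have "pass' S0 = \<sigma>" "insert Q (P - {Q}) = P" using s sets Q by (auto simp: pass'_def)
  ultimately show ?thesis by (simp add: fam_def T_def c_def S0_def)
qed

lemma R_single_holder:
  assumes D: "single_holder M P pr \<sigma> a V \<in> problems MM NN" and i: "i \<in> M"
  shows "R (single_holder M P pr \<sigma> a V) i = rule_PP (single_holder M P pr \<sigma> a V) i"
proof (cases "i \<in> V")
  case False
  then show ?thesis
    using R_unvisited[OF D] rule_PP_dummy[OF D, of i] i by simp
next
  case True
  let ?D = "single_holder M P pr \<sigma> a V"
  have mk: "market MM M P pr" using market_of_problem[OF D] by simp
  obtain Q where Q: "Q \<in> P" "i \<in> Q"
    using partition_on_obtain[OF problemsD(4)[OF D]] i by auto
  \<comment> \<open>By the default convention an index that is not a pass has no holders, so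
    \<open>\<sigma>\<close> is a genuine pass; in the same way \<open>V\<close> is confined to the
    rows of its matrix.\<close>
  have s: "\<sigma> \<in> Ind ` M \<union> {Gen} \<union> Con ` P" using problemsD(13)[OF D, of \<sigma>] by auto
  have a: "a \<in> NN" using problemsD(6)[OF D, of \<sigma>] s by auto
  have V: "V \<subseteq> (case \<sigma> of Ind j \<Rightarrow> {j} | Gen \<Rightarrow> M | Con Q \<Rightarrow> Q)"
    using problemsD(15)[OF D, of \<sigma> _ a] by (fastforce simp: pass_rows_single_holder)
  have visitors: "visitors ?D \<tau> i = (if \<tau> = \<sigma> then {a} else {})" for \<tau>
    using True by (auto simp: visitors_def)
  have PP: "rule_PP ?D i =
    (if \<sigma> = Gen \<or> \<sigma> = Con Q then pr (Ind i) / (\<Sum>j\<in>Q \<inter> V. pr (Ind j)) * consortium_share P pr \<sigma> V Q else 0)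
    + (if \<sigma> = Ind i then pr (Ind i) else 0)"
  proof -
    have [simp]: "K \<inter> V \<noteq> {} \<longleftrightarrow> (\<exists>j\<in>K. j \<in> V)" for K by auto
    have [simp]: "Q \<inter> V = {j. j \<in> Q \<and> j \<in> V}" by auto
    have [simp]: "{j. (j \<in> V \<longrightarrow> j \<in> Q) \<and> j \<in> V} = {j. j \<in> Q \<and> j \<in> V}" by auto
    show ?thesis
      unfolding rule_PP_eq[OF D, unfolded single_holder_simps(2), OF Q] visitors
      by (auto simp: consortium_share_def mult_ac)
  qed
  show ?thesis
  proof (cases \<sigma>)
    case (Ind j)
    then have "V = {i}" "\<sigma> = Ind i" using V True by auto
    then show ?thesis using sum_visited_single_holder[OF D _ s] i PP by simp
  next
    case Gen
    then show ?thesis using R_within_consortium[OF mk a Q(1), of \<sigma> V i] V Q(2) True PP by simp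
  next
    case (Con K)
    then have "K \<in> P" "i \<in> K" using s V True by auto
    then have "K = Q" using consortium_unique[OF problemsD(4)[OF D]] Q by auto
    then show ?thesis using R_within_consortium[OF mk a Q(1), of \<sigma> V i] Con V Q(2) True PP by simp
  qed
qed

end

section \<open>The characterization of the rule by the axioms\<close>

lemma composition_rule_PP: "composition MM NN rule_PP"
  unfolding composition_def by (intro ballI impI, elim conjE) (rule rule_PP_merge)

lemma dummy_rule_PP: "dummy MM NN rule_PP"
  unfolding dummy_def by (intro ballI impI) (rule rule_PP_dummy)

theorem theorem2:
  fixes MM :: "'m set" and NN :: "'h set" and num :: "nat \<Rightarrow> 'm"
    and R :: "('m, 'h) problem \<Rightarrow> 'm \<Rightarrow> real"
  assumes "infinite MM" and "infinite NN"
    and "inj_on num {1..}" and "num ` {1..} \<subseteq> MM"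
    and "is_rule MM NN R"
  shows "composition MM NN R \<and> dummy MM NN R \<and> splitting_proof_museums MM NN R \<and>
      splitting_proof_consortia MM NN R \<and> consortia_consistency MM NN num R \<longleftrightarrow>
    (\<forall>D\<in>problems MM NN. \<forall>i\<in>museums D. R D i = rule_PP D i)"
proof
  assume ax: "composition MM NN R \<and> dummy MM NN R \<and> splitting_proof_museums MM NN R \<and>
      splitting_proof_consortia MM NN R \<and> consortia_consistency MM NN num R"
  then interpret axiomatic_rule MM NN num R
    using assms by unfold_locales auto
  show "\<forall>D\<in>problems MM NN. \<forall>i\<in>museums D. R D i = rule_PP D i"
  proof (intro ballI)
    fix D i
    assume "D \<in> problems MM NN" "i \<in> museums D"
    then show "R D i = rule_PP D i"
      using ax by (intro composition_rule_unique[OF _ _ composition_rule_PP dummy_rule_PP R_single_holder]) auto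
  qed
next
  assume PP: "\<forall>D\<in>problems MM NN. \<forall>i\<in>museums D. R D i = rule_PP D i"
  \<comment> \<open>\<open>R\<close> is known to agree with \<open>rule_PP\<close> only at museums
    of problems, so sums over a consortium are transferred term by term.\<close>
  have sum_PP: "(\<Sum>i\<in>Q. R D i) = (\<Sum>i\<in>Q. rule_PP D i)" if "D \<in> problems MM NN" "Q \<in> consortia D" for D Q
  proof (rule sum.cong[OF refl])
    fix i assume "i \<in> Q"
    then have "i \<in> museums D" using problemsD(4)[OF that(1)] that(2) by (auto simp: partition_on_def)
    then show "R D i = rule_PP D i" using PP that(1) by blast
  qed
  show "composition MM NN R \<and> dummy MM NN R \<and> splitting_proof_museums MM NN R \<and>
      splitting_proof_consortia MM NN R \<and> consortia_consistency MM NN num R"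
  proof (intro conjI)
    show "composition MM NN R"
      unfolding composition_def
    proof (intro ballI impI, elim conjE)
      fix D1 D2 i
      assume D: "D1 \<in> problems MM NN" "D2 \<in> problems MM NN"
        and same: "museums D1 = museums D2" "consortia D1 = consortia D2" "price D1 = price D2"
          "(\<Union>\<sigma>\<in>passes D1. holders D1 \<sigma>) \<inter> (\<Union>\<sigma>\<in>passes D2. holders D2 \<sigma>) = {}"
        and i: "i \<in> museums D1"
      \<comment> \<open>The hypothesis on \<open>R\<close> can be applied to the merge only after
        the merge is known to be a problem itself.\<close>
      show "R (merge D1 D2) i = R D1 i + R D2 i"
        using rule_PP_merge[OF D same i] PP merge_in_problems[OF D same] D i same(1) by simp
    qed
    show "dummy MM NN R"
      using dummy_rule_PP PP unfolding dummy_def by simp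
    show "splitting_proof_museums MM NN R"
      unfolding splitting_proof_museums_def
    proof (intro ballI allI impI)
      fix D D' i I j
      assume D: "D \<in> problems MM NN" "D' \<in> problems MM NN"
        and sp: "splits_museum MM D i I D'" and j: "j \<in> museums D - {i}"
      have "j \<in> museums D'" using sp j by (simp add: splits_museum_def Let_def)
      then show "R D j = R D' j" using rule_PP_splits_museum[OF D sp j] PP D j by simp
    qed
    show "splitting_proof_consortia MM NN R"
      unfolding splitting_proof_consortia_def
    proof (intro ballI allI impI)
      fix D D' K t c Q
      assume D: "D \<in> problems MM NN" "D' \<in> problems MM NN"
        and sp: "splits_consortium MM D K t c D'" and Q: "Q \<in> consortia D - {K}"
      have "Q \<in> consortia D'" using sp Q by (simp add: splits_consortium_def)
      then show "(\<Sum>j\<in>Q. R D j) = (\<Sum>j\<in>Q. R D' j)"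
        using sum_PP[OF D(1), of Q] sum_PP[OF D(2), of Q] Q rule_PP_splits_consortium[OF D sp Q] by simp
    qed
    show "consortia_consistency MM NN num R"
      unfolding consortia_consistency_def
    proof (intro ballI allI impI, elim conjE)
      fix D D' e k
      assume D: "D \<in> general_problems MM NN" "D' \<in> general_problems MM NN"
        and e: "bij_betw e {1..card (consortia D)} (consortia D)" and red: "is_reduced num e D D'"
        and k: "k \<in> {1..card (consortia D)}"
      have P: "D \<in> problems MM NN" "D' \<in> problems MM NN" using D by (auto simp: general_problems_def)
      have inj: "inj_on num {1..card (consortia D)}" using inj_on_subset[OF assms(3)] by auto
      have "num k \<in> museums D'" using red k by (simp add: is_reduced_def Let_def)
      moreover have "e k \<in> consortia D" using bij_betwE[OF e] k by blast
      ultimately show "(\<Sum>i\<in>e k. R D i) = R D' (num k)"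
        using rule_PP_reduced[OF D inj e red k] sum_PP[OF P(1)] PP P(2) by simp
    qed
  qed
qed

end
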